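(* Let $q\geq 2$ be an integer and let $m\in\mathbb{N}$. If $m$ and $q-1$ are coprime, then for all $r\in\{0,1,\ldots,m-1\}$ the set of $n\in\mathbb{N}$ for which $s_q(\Omega(n))\equiv r\bmod m$ has asymptotic density $1/m$.
   Context: $\mathbb{N}=\{1,2,3,\ldots\}$. $\Omega(n)$ denotes the number of prime factors of $n$ counted with multiplicities. $s_q(n)$ denotes the sum of digits of $n$ in base $q$: $s_q(n)=\sum_{k\ge0}a_k$ where $n=\sum_{k\geq0}a_kq^k$ with $a_k\in\{0,1,\ldots,q-1\}$ (so $s_q(0)=0$). A set $A\subset\mathbb{N}$ has asymptotic density $\delta$ if $\lim_{N\to\infty}|A\cap\{1,\ldots,N\}|/N=\delta$. *)

theory Defs
  imports Complex_Main "HOL-Number_Theory.Number_Theory"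
begin

definition big_omega :: "nat \<Rightarrow> nat" where
  "big_omega n = size (prime_factorization n)"

definition digit :: "nat \<Rightarrow> nat \<Rightarrow> nat \<Rightarrow> nat" where
  "digit q n k = (n div q ^ k) mod q"

text \<open>
  The index set contains the positions of all digits up to the leading one. It is finite
  for \<open>q \<ge> 2\<close>; smaller bases are meaningless here.
\<close>
definition digit_sum :: "nat \<Rightarrow> nat \<Rightarrow> nat" where
  "digit_sum q n = (\<Sum>k | q ^ k \<le> n. digit q n k)"

text \<open>The term with index \<open>N = 0\<close> is \<open>0 / 0 = 0\<close> and does not affect the limit.\<close>
definition has_asymptotic_density :: "nat set \<Rightarrow> real \<Rightarrow> bool" where
  "has_asymptotic_density A \<delta> \<longleftrightarrow>
     (\<lambda>N. real (card (A \<inter> {1..N})) / real N) \<longlonglongrightarrow> \<delta>"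

lemma digit_unique_aux:
  assumes "q \<ge> 2" and "\<And>k. a k < q" and "n = (\<Sum>k<K. a k * q ^ k)"
  shows "digit q n k = (if k < K then a k else 0)"
  using assms(2,3)
proof (induction K arbitrary: a n k)
  case 0
  then show ?case by (simp add: digit_def)
next
  case (Suc K)
  define n' where "n' = (\<Sum>k<K. a (Suc k) * q ^ k)"
  have n: "n = a 0 + q * n'"
    unfolding Suc.prems(2) n'_def sum.lessThan_Suc_shift
    by (simp add: sum_distrib_left algebra_simps)
  have a0: "a 0 < q" by (rule Suc.prems(1))
  show ?case
  proof (cases k)
    case 0
    then show ?thesis using n a0 by (simp add: digit_def)
  next
    case (Suc j)
    have "n div q = n'" using n a0 assms(1) by simp
    then have "digit q n k = digit q n' j"
      by (simp add: Suc digit_def div_mult2_eq)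
    also have "\<dots> = (if j < K then a (Suc j) else 0)"
      by (rule Suc.IH) (use Suc.prems(1) n'_def in auto)
    finally show ?thesis using Suc by simp
  qed
qed

lemma finite_digit_positions:
  assumes "(q::nat) \<ge> 2"
  shows "finite {k. q ^ k \<le> n}"
proof (rule finite_subset)
  show "{k. q ^ k \<le> n} \<subseteq> {..n}"
  proof
    fix k assume k: "k \<in> {k. q ^ k \<le> n}"
    have "k < 2 ^ k" by (rule less_exp)
    also have "(2::nat) ^ k \<le> q ^ k" using assms by (rule power_mono) simp
    also have "\<dots> \<le> n" using k by simp
    finally show "k \<in> {..n}" by simp
  qed
qed simp

lemma digit_expansion:
  assumes "q \<ge> 2"
  shows "n = (\<Sum>k | q ^ k \<le> n. digit q n k * q ^ k)" and "digit q n k < q"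
proof -
  have trunc: "(\<Sum>k<K. digit q n k * q ^ k) = n mod q ^ K" for K
  proof (induction K)
    case (Suc K)
    have "n mod (q ^ K * q) = q ^ K * (n div q ^ K mod q) + n mod q ^ K"
      by (rule mod_mult2_eq)
    then show ?case using Suc by (simp add: digit_def algebra_simps)
  qed simp
  have "n < 2 ^ n" by (rule less_exp)
  also have "(2::nat) ^ n \<le> q ^ n" using assms by (rule power_mono) simp
  finally have less: "n < q ^ n" .
  have "(\<Sum>k | q ^ k \<le> n. digit q n k * q ^ k) = (\<Sum>k<n. digit q n k * q ^ k)"
  proof (rule sum.mono_neutral_left)
    show "{k. q ^ k \<le> n} \<subseteq> {..<n}"
    proof
      fix k assume "k \<in> {k. q ^ k \<le> n}"
      then have "q ^ k < q ^ n" using less by simp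
      then show "k \<in> {..<n}" using assms by simp
    qed
  qed (auto simp: digit_def)
  also have "\<dots> = n" using trunc[of n] less by simp
  finally show "n = (\<Sum>k | q ^ k \<le> n. digit q n k * q ^ k)" by simp
  show "digit q n k < q" using assms by (simp add: digit_def)
qed

lemma digit_sum_unique:
  assumes "q \<ge> 2" and "finite {k. a k \<noteq> 0}" and "\<And>k. a k < q"
    and "n = (\<Sum>k | a k \<noteq> 0. a k * q ^ k)"
  shows "digit_sum q n = (\<Sum>k | a k \<noteq> 0. a k)"
proof -
  obtain K where K: "{k. a k \<noteq> 0} \<subseteq> {..<K}"
    using assms(2) finite_nat_iff_bounded by blast
  have "n = (\<Sum>k<K. a k * q ^ k)"
    unfolding assms(4) by (rule sum.mono_neutral_left) (use K in auto)
  from digit_unique_aux[OF assms(1,3) this]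
  have dig: "digit q n k = (if k < K then a k else 0)" for k .
  have dig: "digit q n k = a k" for k
    unfolding dig using K by auto
  have "(\<Sum>k | a k \<noteq> 0. a k) = (\<Sum>k | q ^ k \<le> n. a k)"
  proof (rule sum.mono_neutral_left)
    show "finite {k. q ^ k \<le> n}" using assms(1) by (rule finite_digit_positions)
    show "{k. a k \<noteq> 0} \<subseteq> {k. q ^ k \<le> n}"
    proof
      fix k assume "k \<in> {k. a k \<noteq> 0}"
      then have "digit q n k \<noteq> 0" by (simp add: dig)
      then show "k \<in> {k. q ^ k \<le> n}"
        by (cases "n < q ^ k") (auto simp: digit_def)
    qed
  qed auto
  then show ?thesis by (simp add: digit_sum_def dig)
qed

end

theory Submission
  imports Defs "HOL-Analysis.Harmonic_Numbers" "HOL-Analysis.Complex_Transcendental"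
    "HOL-Computational_Algebra.Squarefree" "HOL-Real_Asymp.Real_Asymp"
begin

text \<open>
  The key fact is that the means of \<open>a (big_omega n)\<close> and \<open>a (big_omega n + 1)\<close> over
  \<open>n \<le> x\<close> agree asymptotically for every bounded \<open>a\<close>. Then \<open>a\<close> can be replaced by its
  averages over long windows, and for \<open>a\<close> depending on the sum of digits modulo \<open>m\<close> these are
  uniformly close to their expected value.

  The key fact is obtained without the prime number theorem, in the spirit of Hildebrand's proof of
  the latter. By the Turan-Kubilius inequality, the mean up to \<open>x\<close> of \<open>a (big_omega n)\<close> is
  close to an average over primes \<open>p\<close> of the means up to \<open>x / p\<close> of
  \<open>a (big_omega n + 1)\<close>, for any large family of primes. On the logarithmic scale, cut into tiles
  of length \<open>\<delta>\<close>, no tile has too large a share of the primes, so by the pigeonhole principle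
  many tiles that contain primes differ by a common small translation. Hence the mean up to \<open>x\<close>
  is almost invariant under a small dilation of \<open>x\<close>, hence under every fixed one, and the
  dilations by \<open>1 / p\<close> can be ignored.
\<close>

section \<open>The Turan-Kubilius inequality\<close>

lemma sum_multiples:
  fixes f :: "nat \<Rightarrow> real"
  assumes "d > 0"
  shows "(\<Sum>n=1..N. of_bool (d dvd n) * f n) = (\<Sum>m=1..N div d. f (d * m))"
proof -
  have "(\<Sum>n=1..N. of_bool (d dvd n) * f n) = (\<Sum>n | n \<in> {1..N} \<and> d dvd n. f n)"
    by (intro sum.mono_neutral_cong_right) auto
  also have "{n. n \<in> {1..N} \<and> d dvd n} = (\<lambda>m. d * m) ` {1..N div d}"
  proof (intro equalityI subsetI)
    fix n assume "n \<in> {n. n \<in> {1..N} \<and> d dvd n}"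
    then obtain m where "n = d * m" "1 \<le> n" "n \<le> N" by auto
    then show "n \<in> (\<lambda>m. d * m) ` {1..N div d}"
      using assms by (auto simp: less_eq_div_iff_mult_less_eq mult.commute intro!: imageI)
  next
    fix n assume "n \<in> (\<lambda>m. d * m) ` {1..N div d}"
    then show "n \<in> {n. n \<in> {1..N} \<and> d dvd n}"
      using assms by (auto simp: less_eq_div_iff_mult_less_eq mult.commute)
  qed
  also have "(\<Sum>n\<in>(\<lambda>m. d * m) ` {1..N div d}. f n) = (\<Sum>m=1..N div d. f (d * m))"
    using assms by (subst sum.reindex) (auto simp: inj_on_def)
  finally show ?thesis .
qed

text \<open>The weighted number \<open>w n\<close> of primes in \<open>P\<close> dividing
  \<open>n\<close> has mean about \<open>L\<close> and mean square deviation at most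
  \<open>2 * L\<close>; Cauchy-Schwarz turns this into a statement about an arbitrary bounded
  \<open>f\<close>. The weights \<open>c\<close> allow only a prescribed share of the primes to be
  used later.\<close>

lemma turan_kubilius:
  fixes c f :: "nat \<Rightarrow> real" and P :: "nat set"
  assumes P: "finite P" "\<And>p. p \<in> P \<Longrightarrow> prime p"
    and c: "\<And>p. p \<in> P \<Longrightarrow> 0 \<le> c p" "\<And>p. p \<in> P \<Longrightarrow> c p \<le> 1"
    and f: "\<And>n. \<bar>f n\<bar> \<le> 1"
    and N: "2 * card P \<le> N"
  defines "L \<equiv> \<Sum>p\<in>P. c p / real p"
  shows "\<bar>(\<Sum>p\<in>P. c p * (\<Sum>m=1..N div p. f (p * m))) - L * (\<Sum>n=1..N. f n)\<bar>
           \<le> real N * sqrt (2 * L)"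
proof -
  define w where "w n = (\<Sum>p\<in>P. c p * of_bool (p dvd n))" for n
  have pos: "p > 0" if "p \<in> P" for p using P(2)[OF that] prime_gt_0_nat by blast
  have L0: "L \<ge> 0" unfolding L_def by (intro sum_nonneg divide_nonneg_nonneg) (auto simp: c)
  have count: "(\<Sum>n=1..N. of_bool (d dvd n)) = real (N div d)" if "d > 0" for d
    using sum_multiples[OF that, where N = N and f = "\<lambda>_. 1"] by simp
  have weighted: "(\<Sum>n=1..N. w n * g n) = (\<Sum>p\<in>P. c p * (\<Sum>m=1..N div p. g (p * m)))"
    for g :: "nat \<Rightarrow> real"
  proof -
    have "(\<Sum>n=1..N. w n * g n) = (\<Sum>n=1..N. \<Sum>p\<in>P. c p * (of_bool (p dvd n) * g n))"
      by (simp add: w_def sum_distrib_right mult.assoc)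
    also have "\<dots> = (\<Sum>p\<in>P. c p * (\<Sum>n=1..N. of_bool (p dvd n) * g n))"
      by (subst sum.swap) (simp only: sum_distrib_left)
    also have "\<dots> = (\<Sum>p\<in>P. c p * (\<Sum>m=1..N div p. g (p * m)))"
      by (intro sum.cong refl arg_cong2[where f = "(*)"] sum_multiples pos)
    finally show ?thesis .
  qed
  \<comment> \<open>A lower bound suffices because the first moment enters the variance with a
    negative sign. Rounding in \<open>N div p\<close> costs at most 1 per prime.\<close>
  have first: "(\<Sum>n=1..N. w n) \<ge> N * L - card P"
  proof -
    have "N * L - card P = (\<Sum>p\<in>P. c p * (N / p) - 1)"
      by (simp add: L_def sum_subtractf sum_distrib_left mult_ac)
    also have "\<dots> \<le> (\<Sum>p\<in>P. c p * real (N div p))"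
    proof (intro sum_mono)
      fix p assume p: "p \<in> P"
      have "real N / real p \<le> real (N div p) + 1"
        using real_of_int_div3[of "int N" "int p"] by (simp flip: zdiv_int)
      then have "c p * (N / p) \<le> c p * (real (N div p) + 1)"
        using c(1)[OF p] by (intro mult_left_mono)
      then show "c p * (N / p) - 1 \<le> c p * real (N div p)"
        using c(2)[OF p] by (simp add: algebra_simps)
    qed
    also have "\<dots> = (\<Sum>n=1..N. w n)" using weighted[of "\<lambda>_. 1"] by simp
    finally show ?thesis .
  qed
  have diagonal: "(\<Sum>r\<in>P. of_bool (p = r) * z) = z" if "p \<in> P" for p and z :: real
    using P(1) that by (simp add: of_bool_def if_distrib[of "\<lambda>b. b * z"] cong: if_cong)
  \<comment> \<open>Distinct primes are coprime, so off the diagonal the count is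
    \<open>N div (p * r)\<close>. On the diagonal \<open>c p * c p \<le> c p\<close> gives the extra
    term, and the nonnegative product term is added there to complete the square
    \<open>L\<^sup>2\<close>.\<close>
  have second: "(\<Sum>n=1..N. (w n)\<^sup>2) \<le> N * L\<^sup>2 + N * L"
  proof -
    have "(\<Sum>n=1..N. (w n)\<^sup>2)
        = (\<Sum>n=1..N. \<Sum>p\<in>P. \<Sum>r\<in>P. c p * c r * of_bool (p dvd n \<and> r dvd n))"
      unfolding w_def power2_eq_square sum_product
      by (intro sum.cong refl) auto
    also have "\<dots> = (\<Sum>p\<in>P. \<Sum>r\<in>P. c p * c r * (\<Sum>n=1..N. of_bool (p dvd n \<and> r dvd n)))"
      by (subst sum.swap, rule sum.cong[OF refl], subst sum.swap) (simp only: sum_distrib_left)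
    also have "\<dots> \<le> (\<Sum>p\<in>P. \<Sum>r\<in>P. N * ((c p / p) * (c r / r)) + of_bool (p = r) * (N * (c p / p)))"
    proof (intro sum_mono)
      fix p r assume p: "p \<in> P" and r: "r \<in> P"
      show "c p * c r * (\<Sum>n=1..N. of_bool (p dvd n \<and> r dvd n))
              \<le> N * ((c p / p) * (c r / r)) + of_bool (p = r) * (N * (c p / p))"
      proof (cases "p = r")
        case True
        have "c p * c r * (\<Sum>n=1..N. of_bool (p dvd n \<and> r dvd n)) = c p * c p * real (N div p)"
          using True count[OF pos[OF p]] by simp
        also have "\<dots> \<le> c p * 1 * (N / p)"
          using c(1,2)[OF p] of_nat_div_le_of_nat[of N p, where 'a = real]
          by (intro mult_mono mult_nonneg_nonneg) auto
        also have "\<dots> \<le> N * ((c p / p) * (c r / r)) + of_bool (p = r) * (N * (c p / p))"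
          using c(1)[OF p] True by (simp add: mult.commute zero_le_divide_iff zero_le_mult_iff)
        finally show ?thesis .
      next
        case False
        then have "coprime p r" using P(2) p r primes_coprime by blast
        then have "p dvd n \<and> r dvd n \<longleftrightarrow> p * r dvd n" for n
          using divides_mult[of p n r] by auto
        then have "c p * c r * (\<Sum>n=1..N. of_bool (p dvd n \<and> r dvd n))
            = c p * c r * real (N div (p * r))"
          using count[of "p * r"] pos p r by simp
        also have "\<dots> \<le> c p * c r * (N / real (p * r))"
          using c(1)[OF p] c(1)[OF r] of_nat_div_le_of_nat[of N "p * r", where 'a = real]
          by (intro mult_left_mono mult_nonneg_nonneg) auto
        also have "\<dots> = N * ((c p / p) * (c r / r)) + of_bool (p = r) * (N * (c p / p))"
          using False by simp
        finally show ?thesis .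
      qed
    qed
    also have "\<dots> = (\<Sum>p\<in>P. \<Sum>r\<in>P. N * ((c p / p) * (c r / r))) + (\<Sum>p\<in>P. N * (c p / p))"
      by (simp only: sum.distrib) (intro arg_cong2[where f = "(+)"] sum.cong refl diagonal)
    also have "\<dots> = N * L\<^sup>2 + N * L"
      unfolding L_def power2_eq_square sum_product by (simp add: sum_distrib_left)
    finally show ?thesis .
  qed
  \<comment> \<open>The terms in \<open>L\<^sup>2\<close> cancel, and
    \<open>2 * card P \<le> N\<close> absorbs the rounding loss into a second
    \<open>N * L\<close>.\<close>
  have variance: "(\<Sum>n=1..N. (w n - L)\<^sup>2) \<le> N * (2 * L)"
  proof -
    have "(\<Sum>n=1..N. (w n - L)\<^sup>2) = (\<Sum>n=1..N. (w n)\<^sup>2) - 2 * L * (\<Sum>n=1..N. w n) + N * L\<^sup>2"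
      by (simp add: power2_diff sum.distrib sum_subtractf sum_distrib_left sum_distrib_right mult_ac)
    also have "\<dots> \<le> N * L\<^sup>2 + N * L - 2 * L * (N * L - card P) + N * L\<^sup>2"
      using second first L0 by (intro add_mono diff_mono mult_left_mono) auto
    also have "\<dots> = N * L + L * real (2 * card P)"
      by (simp add: algebra_simps power2_eq_square)
    also have "\<dots> \<le> N * L + L * N"
      using N L0 by (intro add_left_mono mult_left_mono) linarith+
    finally show ?thesis by (simp add: mult_ac)
  qed
  have "(\<Sum>p\<in>P. c p * (\<Sum>m=1..N div p. f (p * m))) - L * (\<Sum>n=1..N. f n)
      = (\<Sum>n=1..N. (w n - L) * f n)"
    by (simp only: left_diff_distrib sum_subtractf weighted sum_distrib_left[of L])
  also have "\<bar>\<dots>\<bar> \<le> sqrt (N * (N * (2 * L)))"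
  proof -
    have "(\<Sum>n=1..N. (w n - L) * f n)\<^sup>2 \<le> (\<Sum>n=1..N. (w n - L)\<^sup>2) * (\<Sum>n=1..N. (f n)\<^sup>2)"
      by (rule Cauchy_Schwarz_ineq_sum)
    also have "\<dots> \<le> (N * (2 * L)) * (\<Sum>n=1..N. 1)"
      using variance f L0 by (intro mult_mono sum_mono sum_nonneg) (auto simp: abs_square_le_1)
    finally have "(\<Sum>n=1..N. (w n - L) * f n)\<^sup>2 \<le> N * (N * (2 * L))" by (simp add: mult_ac)
    then show ?thesis by (metis real_sqrt_abs real_sqrt_le_iff)
  qed
  also have "sqrt (N * (N * (2 * L))) = N * sqrt (2 * L)"
    by (simp add: real_sqrt_mult)
  finally show ?thesis .
qed

text \<open>The argument is real, and the divisor is \<open>x\<close> rather than its floor, so that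
  \<open>x\<close> can be dilated by arbitrary positive factors.\<close>

definition mean :: "(nat \<Rightarrow> real) \<Rightarrow> real \<Rightarrow> real" where
  "mean f x = (\<Sum>n=1..nat \<lfloor>x\<rfloor>. f n) / x"

lemma abs_sum_le_floor:
  assumes "\<And>n. \<bar>f n\<bar> \<le> (1::real)" "0 \<le> x"
  shows "\<bar>\<Sum>n=1..nat \<lfloor>x\<rfloor>. f n\<bar> \<le> x"
proof -
  have "\<bar>\<Sum>n=1..nat \<lfloor>x\<rfloor>. f n\<bar> \<le> (\<Sum>n=1..nat \<lfloor>x\<rfloor>. 1)"
    by (rule order_trans[OF sum_abs sum_mono]) (rule assms)
  then show ?thesis using assms(2) by simp linarith
qed

text \<open>Slow variation on the logarithmic scale: the additional summands and the change of
  normalisation cost \<open>1 - y / x\<close> each, and \<open>1 / x\<close> pays for the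
  floors.\<close>

lemma mean_lipschitz:
  assumes f: "\<And>n. \<bar>f n\<bar> \<le> 1" and y: "0 < y" "y \<le> x"
  shows "\<bar>mean f x - mean f y\<bar> \<le> 2 * (1 - y / x) + 1 / x"
proof -
  define S where "S z = (\<Sum>n=1..nat \<lfloor>z\<rfloor>. f n)" for z :: real
  have le: "nat \<lfloor>y\<rfloor> \<le> nat \<lfloor>x\<rfloor>" using y by (intro nat_mono floor_mono)
  have "S x - S y = (\<Sum>n\<in>{1..nat \<lfloor>x\<rfloor>} - {1..nat \<lfloor>y\<rfloor>}. f n)"
    unfolding S_def using le by (subst sum_diff) auto
  also have "\<bar>\<dots>\<bar> \<le> (\<Sum>n\<in>{1..nat \<lfloor>x\<rfloor>} - {1..nat \<lfloor>y\<rfloor>}. 1)"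
    by (rule order_trans[OF sum_abs sum_mono]) (rule f)
  also have "\<dots> = real (nat \<lfloor>x\<rfloor> - nat \<lfloor>y\<rfloor>)"
    using le by (subst sum_constant, subst card_Diff_subset) auto
  also have "\<dots> \<le> x - y + 1" using y le by (simp add: of_nat_diff) linarith
  finally have 1: "\<bar>S x - S y\<bar> \<le> x - y + 1" .
  have 2: "\<bar>S y\<bar> \<le> y" unfolding S_def using f y by (intro abs_sum_le_floor) auto
  have "mean f x - mean f y = (S x - S y) / x - S y * (1 / y - 1 / x)"
    using y by (simp add: mean_def S_def field_simps)
  also have "\<bar>\<dots>\<bar> \<le> \<bar>S x - S y\<bar> / x + \<bar>S y\<bar> * (1 / y - 1 / x)"
  proof -
    have "1 / y - 1 / x \<ge> 0" using y by (simp add: field_simps)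
    then show ?thesis using y
      by (intro order_trans[OF abs_triangle_ineq4]) (simp add: abs_mult)
  qed
  also have "\<dots> \<le> (x - y + 1) / x + y * (1 / y - 1 / x)"
    using 1 2 y by (intro add_mono divide_right_mono mult_right_mono) (auto simp: field_simps)
  also have "\<dots> = 2 * (1 - y / x) + 1 / x"
    using y by (simp add: field_simps)
  finally show ?thesis .
qed

lemma big_omega_prime_mult:
  assumes "prime p" "m > 0"
  shows "big_omega (p * m) = Suc (big_omega m)"
  using assms by (simp add: big_omega_def prime_factorization_mult prime_factorization_prime)

text \<open>This is where the shift by one arises: the Turan-Kubilius inequality for
  \<open>a (big_omega n)\<close> involves the values at \<open>p * m\<close>, which are
  \<open>a (Suc (big_omega m))\<close>. Sums up to \<open>N div p\<close> become means at
  \<open>x / p\<close>.\<close>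

lemma turan_kubilius_mean:
  fixes a c :: "nat \<Rightarrow> real" and P :: "nat set" and x :: real
  assumes P: "finite P" "\<And>p. p \<in> P \<Longrightarrow> prime p"
    and c: "\<And>p. p \<in> P \<Longrightarrow> 0 \<le> c p" "\<And>p. p \<in> P \<Longrightarrow> c p \<le> 1"
    and a: "\<And>n. \<bar>a n\<bar> \<le> 1"
    and x: "2 * card P + 1 \<le> x"
  defines "L \<equiv> \<Sum>p\<in>P. c p / real p"
  shows "\<bar>(\<Sum>p\<in>P. c p / p * mean (\<lambda>n. a (Suc (big_omega n))) (x / p)) - L * mean (\<lambda>n. a (big_omega n)) x\<bar>
           \<le> sqrt (2 * L)"
proof -
  define N where "N = nat \<lfloor>x\<rfloor>"
  have x0: "x > 0" using x by linarith
  have L0: "L \<ge> 0" unfolding L_def by (intro sum_nonneg divide_nonneg_nonneg) (auto simp: c)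
  have N: "2 * card P \<le> N" unfolding N_def using x by linarith
  have Nx: "real N \<le> x" unfolding N_def using x0 by linarith
  have "(\<Sum>p\<in>P. c p / p * mean (\<lambda>n. a (Suc (big_omega n))) (x / p)) 
      = (\<Sum>p\<in>P. c p * (\<Sum>m=1..N div p. a (big_omega (p * m)))) / x"
    unfolding sum_divide_distrib
  proof (intro sum.cong refl)
    fix p assume p: "p \<in> P"
    have p0: "p > 0" using P(2)[OF p] prime_gt_0_nat by blast
    have "nat \<lfloor>x / p\<rfloor> = N div p"
      unfolding N_def using floor_divide_real_eq_div[of "int p" x] x0 by (simp add: nat_div_distrib)
    moreover have "(\<Sum>m=1..N div p. a (Suc (big_omega m))) = (\<Sum>m=1..N div p. a (big_omega (p * m)))"
      using P(2)[OF p] by (intro sum.cong refl) (simp add: big_omega_prime_mult)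
    ultimately show "c p / p * mean (\<lambda>n. a (Suc (big_omega n))) (x / p)
        = c p * (\<Sum>m=1..N div p. a (big_omega (p * m))) / x"
      using p0 x0 by (simp add: mean_def)
  qed
  then have "\<bar>(\<Sum>p\<in>P. c p / p * mean (\<lambda>n. a (Suc (big_omega n))) (x / p)) - L * mean (\<lambda>n. a (big_omega n)) x\<bar>
     = \<bar>(\<Sum>p\<in>P. c p * (\<Sum>m=1..N div p. a (big_omega (p * m)))) - L * (\<Sum>n=1..N. a (big_omega n))\<bar> / x"
    using x0 by (simp add: mean_def N_def field_simps)
  also have "\<dots> \<le> (real N * sqrt (2 * L)) / x"
    unfolding L_def using x0 P c a N
    by (intro divide_right_mono turan_kubilius) auto
  also have "\<dots> \<le> sqrt (2 * L)"
    using Nx x0 L0 by (simp add: divide_le_eq mult.commute[of _ x] mult_right_mono)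
  finally show ?thesis .
qed

section \<open>Primes on the logarithmic scale\<close>

lemma ln_less_iff: "0 < x \<Longrightarrow> ln x < y \<longleftrightarrow> x < exp y" for x y :: real
  by (metis ln_ge_iff not_le)

section \<open>Euler's lower bound for the sum of the reciprocals of the primes\<close>

lemma sum_inverse_squares_le: "(\<Sum>k=1..Suc n. 1 / (real k)\<^sup>2) \<le> 2 - 1 / Suc n"
proof (induction n)
  case (Suc n)
  have "1 / (real (Suc (Suc n)))\<^sup>2 \<le> 1 / (real (Suc n) * real (Suc (Suc n)))"
    by (intro divide_left_mono) (auto simp: power2_eq_square)
  also have "\<dots> = 1 / Suc n - 1 / Suc (Suc n)"
    by (simp add: field_simps)
  finally show ?case using Suc by simp
qed simp

lemma squarefree_eq_prod_prime_factors:
  assumes "squarefree (n::nat)"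
  shows "n = \<Prod>(prime_factors n)"
proof -
  have n: "n \<noteq> 0" using assms not_squarefree_0 by metis
  have "n = (\<Prod>p\<in>prime_factors n. p ^ multiplicity p n)"
    using prod_prime_factors[OF n] by simp
  also have "\<dots> = \<Prod>(prime_factors n)"
  proof (intro prod.cong refl)
    fix p assume p: "p \<in> prime_factors n"
    then have "multiplicity p n = 1"
      using assms squarefree_factorial_semiring''[OF n] n
      by (metis One_nat_def Suc_leI antisym in_prime_factors_iff prime_factors_multiplicity mem_Collect_eq)
    then show "p ^ multiplicity p n = p" by simp
  qed
  finally show ?thesis .
qed

text \<open>Writing \<open>n = k\<^sup>2 * \<Prod>A\<close> with \<open>A\<close> the set of prime factors of the squarefree part,
  the harmonic sum is dominated by \<open>(\<Sum>k. 1 / k\<^sup>2) * (\<Sum>A. 1 / \<Prod>A)\<close>.\<close>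
lemma harm_le_prod_primes:
  assumes "X \<ge> 1"
  shows "harm X \<le> 2 * (\<Prod>p | prime p \<and> p \<le> X. 1 + 1 / real p)"
proof -
  define P where "P = {p. prime p \<and> p \<le> X}"
  have finP: "finite P" unfolding P_def by (rule finite_subset[of _ "{..X}"]) auto
  \<comment> \<open>By \<open>dec\<close>, \<open>g\<close> is injective, and \<open>h (g n)\<close>
    is \<open>1 / n\<close>. The harmonic sum is thus part of a sum of nonnegative terms over a full
    product set, which factorises.\<close>
  define g where "g n = (square_part n, prime_factors (squarefree_part n))" for n :: nat
  define h where "h = (\<lambda>(k::nat, A::nat set). 1 / (real k)\<^sup>2 * (\<Prod>p\<in>A. 1 / real p))"
  have dec: "n = \<Prod>(prime_factors (squarefree_part n)) * (square_part n)\<^sup>2" for n :: nat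
    using squarefree_decompose[of n] squarefree_eq_prod_prime_factors[of "squarefree_part n"]
    by simp
  have "harm X = (\<Sum>n=1..X. h (g n))"
    unfolding harm_def
  proof (intro sum.cong refl)
    fix n assume "n \<in> {1..X}"
    have "inverse (real n) = 1 / (real (square_part n))\<^sup>2 * (1 / real (\<Prod>(prime_factors (squarefree_part n))))"
      by (subst dec[of n]) (simp add: field_simps)
    then show "inverse (real n) = h (g n)" by (simp add: h_def g_def prod_dividef)
  qed
  also have "\<dots> = (\<Sum>z\<in>g ` {1..X}. h z)"
  proof (subst sum.reindex)
    show "inj_on g {1..X}"
      by (rule inj_onI) (metis dec g_def prod.inject)
  qed simp
  also have "\<dots> \<le> (\<Sum>z\<in>{1..X} \<times> Pow P. h z)"
  proof (rule sum_mono2)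
    show "finite ({1..X} \<times> Pow P)" using finP by simp
    show "g ` {1..X} \<subseteq> {1..X} \<times> Pow P"
    proof (rule image_subsetI)
      fix n assume n: "n \<in> {1..X}"
      have "square_part n dvd n"
        using square_part_square_dvd[of n] by (metis dvd_mult_left power2_eq_square)
      moreover have "square_part n > 0" using n by (intro Nat.gr0I) auto
      moreover have "squarefree_part n dvd n" by (metis squarefree_decompose dvd_triv_left)
      moreover have "p \<le> X" if "p \<in> prime_factors (squarefree_part n)" for p
      proof -
        have "p dvd n" using that calculation(3) by (auto dest: dvd_trans)
        then show ?thesis using n by (auto dest: dvd_imp_le)
      qed
      ultimately show "g n \<in> {1..X} \<times> Pow P"
        using n by (auto simp: g_def P_def dest: dvd_imp_le)
    qed
    show "0 \<le> h z" for z by (auto simp: h_def intro!: prod_nonneg divide_nonneg_nonneg split: prod.split)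
  qed
  also have "\<dots> = (\<Sum>k=1..X. 1 / (real k)\<^sup>2) * (\<Sum>A\<in>Pow P. \<Prod>p\<in>A. 1 / real p)"
    unfolding h_def by (simp add: sum_product sum.cartesian_product)
  also have "(\<Sum>A\<in>Pow P. \<Prod>p\<in>A. 1 / real p) = (\<Prod>p\<in>P. 1 + 1 / real p)"
    using prod_add[OF finP, of "\<lambda>p. 1 / real p" "\<lambda>_. 1"] by (simp add: add.commute)
  also have "(\<Sum>k=1..X. 1 / (real k)\<^sup>2) * (\<Prod>p\<in>P. 1 + 1 / real p) \<le> 2 * (\<Prod>p\<in>P. 1 + 1 / real p)"
  proof (intro mult_right_mono prod_nonneg)
    show "(\<Sum>k=1..X. 1 / (real k)\<^sup>2) \<le> 2"
      using sum_inverse_squares_le[of "X - 1"] assms by (auto intro: order_trans)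
  qed auto
  finally show ?thesis unfolding P_def .
qed

text \<open>Euler's argument: bound the product over primes by \<open>1 + t \<le> exp t\<close>,
  compare with \<open>ln (X + 1) \<le> harm X\<close> and take logarithms.\<close>

lemma sum_inverse_primes_ge:
  assumes "X \<ge> 1"
  shows "ln (ln (real X + 1)) - ln 2 \<le> (\<Sum>p | prime p \<and> p \<le> X. 1 / real p)"
proof -
  have "ln (real X + 1) \<le> harm X" by (rule harm_ge_ln)
  also have "\<dots> \<le> 2 * (\<Prod>p | prime p \<and> p \<le> X. 1 + 1 / real p)"
    by (rule harm_le_prod_primes[OF assms])
  also have "\<dots> \<le> 2 * (\<Prod>p | prime p \<and> p \<le> X. exp (1 / real p))"
    by (intro mult_left_mono prod_mono) (auto simp: add_nonneg_nonneg)
  also have "\<dots> = exp (ln 2 + (\<Sum>p | prime p \<and> p \<le> X. 1 / real p))"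
  proof -
    have "finite {p. prime p \<and> p \<le> X}" by (rule finite_subset[of _ "{..X}"]) auto
    then show ?thesis by (simp add: exp_add exp_sum)
  qed
  finally have "ln (ln (real X + 1)) \<le> ln 2 + (\<Sum>p | prime p \<and> p \<le> X. 1 / real p)"
    using assms by (metis exp_gt_zero ln_exp ln_le_cancel_iff ln_gt_zero of_nat_0_less_iff
      less_add_same_cancel2 less_le_trans zero_less_one)
  then show ?thesis by simp
qed

text \<open>In terms of \<open>ln p\<close> the tiles are consecutive half-open intervals of length
  \<open>\<delta>\<close>, so a dilation by \<open>exp (\<delta> * k)\<close> acts as a shift of the
  index by \<open>k\<close>.\<close>

definition tile :: "real \<Rightarrow> nat \<Rightarrow> nat set" where
  "tile \<delta> u = {p. prime p \<and> exp (\<delta> * u) \<le> real p \<and> real p < exp (\<delta> * Suc u)}"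

definition tile_weight :: "real \<Rightarrow> nat \<Rightarrow> real" where
  "tile_weight \<delta> u = (\<Sum>p\<in>tile \<delta> u. 1 / real p)"

lemma finite_tile [simp]: "finite (tile \<delta> u)"
proof (rule finite_subset)
  show "tile \<delta> u \<subseteq> {..nat \<lceil>exp (\<delta> * Suc u)\<rceil>}"
    unfolding tile_def by (auto simp del: of_nat_Suc) linarith
qed simp

lemma tile_weight_nonneg: "tile_weight \<delta> u \<ge> 0"
  unfolding tile_weight_def by (intro sum_nonneg) auto

lemma tile_index_unique:
  assumes "\<delta> > 0" "p \<in> tile \<delta> u"
  shows "u = nat \<lfloor>ln p / \<delta>\<rfloor>"
proof -
  have "real p > 0" using assms by (auto simp: tile_def prime_gt_0_nat)
  then have "\<delta> * u \<le> ln p" "ln p < \<delta> * Suc u"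
    using assms by (auto simp: tile_def ln_ge_iff ln_less_iff simp del: of_nat_Suc)
  then have "\<lfloor>ln p / \<delta>\<rfloor> = int u"
    using assms(1) by (intro floor_unique) (auto simp: field_simps)
  then show ?thesis by simp
qed

lemma tile_disjoint:
  assumes "\<delta> > 0" "u \<noteq> v"
  shows "tile \<delta> u \<inter> tile \<delta> v = {}"
  using tile_index_unique[OF assms(1)] assms(2) by blast

lemma sum_tile_weight_ge:
  assumes "\<delta> > 0" "V \<ge> 1"
  shows "ln V + ln \<delta> - ln 2 \<le> (\<Sum>u<V. tile_weight \<delta> u)"
proof -
  \<comment> \<open>The largest integer strictly below \<open>exp (\<delta> * V)\<close>: primes up
    to \<open>X\<close> stay inside the tiles, which exclude their right ends, while
    \<open>X + 1\<close> still reaches \<open>exp (\<delta> * V)\<close>.\<close>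
  define X where "X = nat (\<lceil>exp (\<delta> * V)\<rceil> - 1)"
  have "exp (\<delta> * V) > 1" using assms by simp
  then have X: "real X < exp (\<delta> * V)" "exp (\<delta> * V) \<le> real X + 1" "X \<ge> 1"
    unfolding X_def by linarith+
  have "ln V + ln \<delta> = ln (\<delta> * V)" using assms by (simp add: ln_mult)
  also have "\<dots> \<le> ln (ln (real X + 1))"
  proof (subst ln_le_cancel_iff)
    show "0 < \<delta> * real V" using assms by simp
    show "\<delta> * real V \<le> ln (real X + 1)" using X by (simp add: ln_ge_iff)
    show "0 < ln (real X + 1)" using X by simp
  qed
  also have "\<dots> \<le> ln 2 + (\<Sum>p | prime p \<and> p \<le> X. 1 / real p)"
    using sum_inverse_primes_ge[OF X(3)] by simp
  also have "(\<Sum>p | prime p \<and> p \<le> X. 1 / real p) \<le> (\<Sum>p\<in>(\<Union>u<V. tile \<delta> u). 1 / real p)"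
  proof (rule sum_mono2)
    show "{p. prime p \<and> p \<le> X} \<subseteq> (\<Union>u<V. tile \<delta> u)"
    proof
      fix p assume p: "p \<in> {p. prime p \<and> p \<le> X}"
      then have p1: "real p > 1" by (auto dest: prime_gt_1_nat)
      define u where "u = nat \<lfloor>ln p / \<delta>\<rfloor>"
      have "0 \<le> ln p / \<delta>" using p1 assms by simp
      then have "real u \<le> ln p / \<delta>" "ln p / \<delta> < real u + 1" unfolding u_def by linarith+
      then have u: "\<delta> * u \<le> ln p" "ln p < \<delta> * Suc u" using assms by (simp_all add: field_simps)
      have "ln p < \<delta> * V" using p X p1 by (subst ln_less_iff) auto
      then have "\<delta> * u < \<delta> * V" using u by linarith
      then have "u < V" using assms by simp
      moreover have "p \<in> tile \<delta> u"
        using u p p1 by (auto simp: tile_def ln_ge_iff ln_less_iff simp del: of_nat_Suc)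
      ultimately show "p \<in> (\<Union>u<V. tile \<delta> u)" by blast
    qed
  qed auto
  also have "(\<Sum>p\<in>(\<Union>u<V. tile \<delta> u). 1 / real p) = (\<Sum>u<V. tile_weight \<delta> u)"
    unfolding tile_weight_def using assms
    by (intro sum.UNION_disjoint) (auto simp: tile_disjoint)
  finally show ?thesis by simp
qed

section \<open>An upper bound for the primes in a single tile\<close>

lemma prod_primes_dvd:
  assumes "finite P" "\<And>p. p \<in> P \<Longrightarrow> prime p" "\<And>p. p \<in> P \<Longrightarrow> p dvd (n::nat)"
  shows "\<Prod>P dvd n"
  using assms
proof (induction P rule: finite_induct)
  case (insert p P)
  have "coprime p (\<Prod>P)"
  proof (rule prod_coprime_right)
    fix q assume "q \<in> P"
    then show "coprime p q" using insert by (intro primes_coprime) auto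
  qed
  then show ?case using insert by (simp add: divides_mult)
qed simp

text \<open>A single term of the binomial expansion of \<open>(1 + t) ^ N\<close> is at most the
  whole, and \<open>1 + t \<le> exp t\<close>.\<close>

lemma choose_le_exp:
  assumes "0 < t"
  shows "real (N choose M) \<le> exp (M * ln (1 / t) + t * N)"
proof -
  have "real (N choose M) * t ^ M \<le> (1 + t) ^ N"
  proof (cases "M \<le> N")
    case True
    have "real (N choose M) * t ^ M \<le> (\<Sum>k\<le>N. real (N choose k) * t ^ k)"
      using assms True by (intro member_le_sum) auto
    then show ?thesis using binomial_ring[of t 1 N] by (simp add: add.commute)
  qed (use assms in \<open>simp add: binomial_eq_0\<close>)
  also have "\<dots> \<le> exp t ^ N" using assms by (intro power_mono) auto
  finally have "real (N choose M) \<le> exp t ^ N * (1 / t) ^ M"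
    using assms by (simp add: field_simps)
  also have "(1 / t) ^ M = exp (M * ln (1 / t))" using assms by (simp add: exp_of_nat_mult)
  also have "exp t ^ N = exp (t * N)" by (simp add: exp_of_nat2_mult)
  finally show ?thesis by (simp add: exp_add mult.commute)
qed

text \<open>All primes in a tile divide one binomial coefficient. The bound loses a factor
  \<open>ln (1 / \<delta>)\<close> against the expected order \<open>1 / u\<close>, but \<open>\<delta> * ln (1 / \<delta>)\<close> still
  tends to \<open>0\<close>.\<close>
lemma tile_weight_le:
  assumes \<delta>: "0 < \<delta>" "\<delta> \<le> 1 / 6"
  shows "\<forall>\<^sub>F u in sequentially. tile_weight \<delta> u \<le> 3 * (ln (1 / \<delta>) + 1) / u"
proof -
  have "filterlim (\<lambda>u. exp (\<delta> * real u)) at_top sequentially"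
    using \<delta> by (intro filterlim_compose[OF exp_at_top] filterlim_tendsto_pos_mult_at_top[OF tendsto_const]
      filterlim_real_sequentially)
  \<comment> \<open>With \<open>y\<close> the left end of the tile, this says
    \<open>\<delta> * y \<ge> 1\<close>, so that rounding errors of size 1 can be absorbed in
    multiples of \<open>\<delta> * y\<close>.\<close>
  then have "\<forall>\<^sub>F u in sequentially. exp (\<delta> * real u) \<ge> 1 / \<delta>"
    by (simp add: filterlim_at_top)
  moreover have "\<forall>\<^sub>F u :: nat in sequentially. u > 0" by (rule eventually_gt_at_top)
  ultimately show ?thesis
  proof eventually_elim
    case (elim u)
    define y where "y = exp (\<delta> * u)"
    \<comment> \<open>\<open>K\<close> and \<open>N\<close> are the largest integers strictly below
      the two ends of the tile, so its primes lie in \<open>{K<..N}\<close>, an interval of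
      \<open>M\<close> integers.\<close>
    define K where "K = nat (\<lceil>y\<rceil> - 1)"
    define N where "N = nat (\<lceil>y * exp \<delta>\<rceil> - 1)"
    define M where "M = N - K"
    define T where "T = tile \<delta> u"
    have y: "\<delta> * y \<ge> 1" "y > 0" using elim \<delta> by (simp_all add: y_def field_simps)
    have "\<delta> * y \<le> 1 / 6 * y" using \<delta> y by (intro mult_right_mono) auto
    then have y6: "y \<ge> 6" using y by linarith
    have e\<delta>: "exp \<delta> \<ge> 1" "exp \<delta> \<le> 1 + 2 * \<delta>"
    proof -
      have "exp \<delta> \<le> 1 + \<delta> + \<delta>\<^sup>2" using \<delta> by (intro exp_bound) auto
      moreover have "\<delta>\<^sup>2 \<le> \<delta>" using \<delta> by (simp add: power2_eq_square mult_le_cancel_left1)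
      ultimately show "exp \<delta> \<le> 1 + 2 * \<delta>" by linarith
    qed (use \<delta> in simp)
    have ye: "y \<le> y * exp \<delta>" using e\<delta> y by simp
    have ye2: "y * exp \<delta> \<le> y + 2 * (\<delta> * y)"
      using mult_left_mono[OF e\<delta>(2), of y] y by (simp add: algebra_simps)
    have "y * \<delta> \<le> y * (1 / 6)" using \<delta> y by (intro mult_left_mono) auto
    then have \<delta>y: "\<delta> * y \<le> y / 6" by (simp add: mult.commute)
    have K: "real K < y" "y \<le> real K + 1" and N: "real N < y * exp \<delta>" "y * exp \<delta> \<le> real N + 1"
      unfolding K_def N_def using y6 ye by linarith+
    have "K \<le> N" unfolding K_def N_def using ye by (intro nat_mono diff_right_mono ceiling_mono)
    then have M: "real M = real N - real K" by (simp add: M_def of_nat_diff)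
    have M3: "real M \<le> 3 * (\<delta> * y)" using M N K ye2 y by linarith
    have N3: "real N \<le> 3 * y" using N ye2 \<delta>y y by linarith
    have T: "prime p" "K < p" "p \<le> N" "y \<le> real p" if "p \<in> T" for p
    proof -
      have *: "prime p" "y \<le> real p" "real p < y * exp \<delta>"
        using that by (auto simp: T_def tile_def y_def ring_distribs exp_add mult.commute)
      then have "real K < real p" "real p < real N + 1" using K N by linarith+
      with * show "prime p" "K < p" "p \<le> N" "y \<le> real p" by auto
    qed
    \<comment> \<open>A prime of the tile divides \<open>fact N\<close>, but it exceeds both
      \<open>K\<close> and \<open>M\<close>, the latter because
      \<open>M \<le> 3 * (\<delta> * y) \<le> y / 2\<close>. So it must divide the binomial
      coefficient.\<close>
    have "\<Prod>T dvd (N choose M)"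
    proof (rule prod_primes_dvd)
      fix p assume p: "p \<in> T"
      have "p dvd fact N" using T[OF p] by (simp add: prime_dvd_fact_iff)
      also have "fact N = fact M * fact K * (N choose M)"
        using binomial_fact_lemma[of M N] \<open>K \<le> N\<close> by (simp add: M_def)
      finally have *: "p dvd fact M * fact K * (N choose M)" .
      have "real M < real p" using M3 \<delta>y T(4)[OF p] y6 by linarith
      then have "\<not> p dvd fact M" "\<not> p dvd fact K" using T[OF p] by (auto simp: prime_dvd_fact_iff)
      with * show "p dvd (N choose M)" using T(1)[OF p] by (auto simp: prime_dvd_mult_iff)
    qed (use T in \<open>auto simp: T_def\<close>)
    moreover have "N choose M > 0" by (simp add: M_def)
    ultimately have "\<Prod>T \<le> (N choose M)" by (intro dvd_imp_le)
    have "y ^ card T \<le> (\<Prod>p\<in>T. real p)"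
      using T(4) y by (subst prod_constant[symmetric], intro prod_mono) auto
    also have "\<dots> \<le> real (N choose M)" using \<open>\<Prod>T \<le> (N choose M)\<close>
      by (simp flip: of_nat_prod)
    \<comment> \<open>The choice \<open>t = \<delta>\<close> makes both terms of the exponent
      \<open>O(\<delta> * y)\<close> up to the factor \<open>ln (1 / \<delta>)\<close>.\<close>
    also have "\<dots> \<le> exp (M * ln (1 / \<delta>) + \<delta> * N)" using \<delta> by (intro choose_le_exp)
    also have "\<dots> \<le> exp (3 * (\<delta> * y) * ln (1 / \<delta>) + \<delta> * (3 * y))"
      using \<delta> M3 N3 by (intro iffD2[OF exp_le_cancel_iff] add_mono mult_right_mono mult_left_mono) auto
    also have "y ^ card T = exp (card T * (\<delta> * u))" by (simp add: y_def exp_of_nat_mult)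
    finally have "card T * (\<delta> * u) \<le> 3 * (\<delta> * y) * ln (1 / \<delta>) + \<delta> * (3 * y)" by simp
    also have "\<dots> = \<delta> * (y * (3 * (ln (1 / \<delta>) + 1)))" by (simp add: algebra_simps)
    finally have "\<delta> * (card T * u) \<le> \<delta> * (y * (3 * (ln (1 / \<delta>) + 1)))" by (simp add: mult_ac)
    then have card: "card T * u \<le> y * (3 * (ln (1 / \<delta>) + 1))" using \<delta> by simp
    have "tile_weight \<delta> u \<le> (\<Sum>p\<in>T. 1 / y)"
      unfolding tile_weight_def T_def[symmetric] using T(4) y
      by (intro sum_mono frac_le) auto
    also have "\<dots> = card T / y" by simp
    also have "\<dots> \<le> 3 * (ln (1 / \<delta>) + 1) / u"
      using card y elim(2) by (simp add: field_simps)
    finally show ?case .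
  qed
qed

section \<open>Small dilations\<close>

text \<open>Turan-Kubilius with the primes of tile \<open>u\<close> carrying total mass
  \<open>\<mu> u\<close>; slow variation then lets \<open>x / p\<close> be replaced by
  \<open>x / exp (\<delta> * u)\<close>. Since \<open>sqrt (2 * L)\<close> is small against
  \<open>L\<close> when \<open>L\<close> is large, the relative error is then essentially
  \<open>3 * \<delta>\<close>.\<close>

lemma tile_mean_approx:
  fixes a \<mu> :: "_ \<Rightarrow> real"
  assumes a: "\<And>n. \<bar>a n\<bar> \<le> 1" and \<delta>: "\<delta> > 0" and F: "finite F"
    and \<mu>: "\<And>u. u \<in> F \<Longrightarrow> 0 \<le> \<mu> u" "\<And>u. u \<in> F \<Longrightarrow> \<mu> u \<le> tile_weight \<delta> u"
  defines "L \<equiv> \<Sum>u\<in>F. \<mu> u"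
  shows "\<forall>\<^sub>F x in at_top.
    \<bar>(\<Sum>u\<in>F. \<mu> u * mean (\<lambda>n. a (Suc (big_omega n))) (x / exp (\<delta> * u)))
       - L * mean (\<lambda>n. a (big_omega n)) x\<bar> \<le> sqrt (2 * L) + 3 * \<delta> * L"
proof -
  define f f' where "f = (\<lambda>n. a (big_omega n))" and "f' = (\<lambda>n. a (Suc (big_omega n)))"
  define P where "P = (\<Union>u\<in>F. tile \<delta> u)"
  define idx where "idx p = nat \<lfloor>ln (real p) / \<delta>\<rfloor>" for p
  \<comment> \<open>Constant on each tile and scaled so that its mass becomes
    \<open>\<mu> u\<close>. If the tile weight is 0, then \<open>\<mu> u = 0\<close> is
    forced.\<close>
  define c where "c p = \<mu> (idx p) / tile_weight \<delta> (idx p)" for p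
  have idx: "idx p = u" if "p \<in> tile \<delta> u" for p u
    using tile_index_unique[OF \<delta> that] by (simp add: idx_def)
  have split: "(\<Sum>p\<in>P. g p) = (\<Sum>u\<in>F. \<Sum>p\<in>tile \<delta> u. g p)" for g :: "nat \<Rightarrow> real"
    unfolding P_def using F tile_disjoint[OF \<delta>] by (intro sum.UNION_disjoint) auto
  have weight: "(\<Sum>p\<in>tile \<delta> u. c p / p) = \<mu> u" if "u \<in> F" for u
  proof -
    have "(\<Sum>p\<in>tile \<delta> u. c p / p) = (\<Sum>p\<in>tile \<delta> u. \<mu> u / tile_weight \<delta> u * (1 / p))"
      by (intro sum.cong refl) (simp add: c_def idx)
    also have "\<dots> = \<mu> u / tile_weight \<delta> u * tile_weight \<delta> u"
      by (simp add: tile_weight_def sum_distrib_left)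
    also have "\<dots> = \<mu> u" using \<mu>[OF that] by (cases "tile_weight \<delta> u = 0") auto
    finally show ?thesis .
  qed
  have P: "finite P" "\<And>p. p \<in> P \<Longrightarrow> prime p"
    unfolding P_def using F by (simp, auto simp: tile_def)
  have c: "0 \<le> c p" "c p \<le> 1" if "p \<in> P" for p
  proof -
    obtain u where "u \<in> F" "idx p = u" using \<open>p \<in> P\<close> idx by (auto simp: P_def)
    then show "0 \<le> c p" "c p \<le> 1"
      using \<mu>[of u] tile_weight_nonneg[of \<delta> u] by (auto simp: c_def divide_le_eq_1)
  qed
  have L: "(\<Sum>p\<in>P. c p / p) = L" unfolding split L_def by (intro sum.cong refl weight)
  \<comment> \<open>This makes the term \<open>1 / x\<close> of \<open>mean_lipschitz\<close> at
    most \<open>\<delta>\<close>; its other term contributes \<open>2 * \<delta>\<close>.\<close>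
  have "\<forall>\<^sub>F x in at_top. \<forall>u\<in>F. exp (\<delta> * u) / \<delta> \<le> x"
    using F by (intro eventually_ball_finite ballI eventually_ge_at_top)
  moreover have "\<forall>\<^sub>F x :: real in at_top. 2 * card P + 1 \<le> x" by (rule eventually_ge_at_top)
  ultimately show ?thesis
  proof eventually_elim
    case (elim x)
    have x0: "x > 0" using elim(2) by linarith
    have "(\<Sum>u\<in>F. \<mu> u * mean f' (x / exp (\<delta> * u)))
        = (\<Sum>u\<in>F. \<Sum>p\<in>tile \<delta> u. c p / p * mean f' (x / exp (\<delta> * u)))"
      by (intro sum.cong refl) (simp only: weight flip: sum_distrib_right)
    then have "(\<Sum>p\<in>P. c p / p * mean f' (x / p)) - (\<Sum>u\<in>F. \<mu> u * mean f' (x / exp (\<delta> * u)))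
        = (\<Sum>u\<in>F. \<Sum>p\<in>tile \<delta> u. c p / p * (mean f' (x / p) - mean f' (x / exp (\<delta> * u))))"
      by (simp add: split sum_subtractf right_diff_distrib)
    also have "\<bar>\<dots>\<bar> \<le> (\<Sum>u\<in>F. \<Sum>p\<in>tile \<delta> u. c p / p * (3 * \<delta>))"
    proof (rule order_trans[OF sum_abs sum_mono], rule order_trans[OF sum_abs sum_mono])
      fix u p assume u: "u \<in> F" and p: "p \<in> tile \<delta> u"
      let ?y = "exp (\<delta> * u)"
      have bounds: "?y \<le> p" "p < ?y * exp \<delta>"
        using p by (auto simp: tile_def ring_distribs exp_add mult.commute)
      have p0: "real p > 0" using bounds(1) by (rule less_le_trans[OF exp_gt_zero])
      have "\<bar>mean f' (x / ?y) - mean f' (x / p)\<bar> \<le> 2 * (1 - (x / p) / (x / ?y)) + 1 / (x / ?y)"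
        using a bounds x0 p0 by (intro mean_lipschitz) (auto simp: f'_def intro: divide_left_mono)
      also have "(x / p) / (x / ?y) = ?y / p" using x0 by simp
      also have "1 / (x / ?y) \<le> \<delta>"
        using elim(1) u x0 \<delta> by (simp add: field_simps)
      also have "1 - ?y / p \<le> \<delta>"
      proof -
        have "1 - \<delta> \<le> exp (- \<delta>)" using exp_ge_add_one_self[of "-\<delta>"] by simp
        also have "\<dots> \<le> ?y / p" using bounds p0 by (simp add: exp_minus field_simps)
        finally show ?thesis by simp
      qed
      finally have *: "\<bar>mean f' (x / p) - mean f' (x / ?y)\<bar> \<le> 3 * \<delta>" by (simp add: abs_minus_commute)
      show "\<bar>c p / p * (mean f' (x / p) - mean f' (x / ?y))\<bar> \<le> c p / p * (3 * \<delta>)"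
      proof -
        have "p \<in> P" using u p by (auto simp: P_def)
        then have "0 \<le> c p / p" by (simp add: c)
        with * show ?thesis unfolding abs_mult by (intro mult_mono) auto
      qed
    qed
    also have "\<dots> = 3 * \<delta> * L"
      unfolding split[symmetric] sum_distrib_right[symmetric] L by simp
    finally have "\<bar>(\<Sum>p\<in>P. c p / p * mean f' (x / p))
        - (\<Sum>u\<in>F. \<mu> u * mean f' (x / exp (\<delta> * u)))\<bar> \<le> 3 * \<delta> * L" .
    moreover have "\<bar>(\<Sum>p\<in>P. c p / p * mean f' (x / p)) - L * mean f x\<bar> \<le> sqrt (2 * L)"
      unfolding L[symmetric] f_def f'_def using P c a elim(2) by (intro turan_kubilius_mean) auto
    ultimately show ?case unfolding f_def f'_def by linarith
  qed
qed

text \<open>Both means are compared with the same average of means of \<open>a \<circ> Suc \<circ> big_omega\<close>: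
  the primes in the tiles \<open>u\<close> are used at \<open>x\<close>, those in the tiles \<open>u + k\<close> at
  \<open>x * exp (\<delta> * k)\<close>.\<close>
lemma mean_shift_of_overlap:
  fixes a :: "nat \<Rightarrow> real"
  assumes a: "\<And>n. \<bar>a n\<bar> \<le> 1" and \<delta>: "\<delta> > 0"
    and overlap: "\<not> summable (\<lambda>u. min (tile_weight \<delta> u) (tile_weight \<delta> (u + k)))"
  shows "\<forall>\<^sub>F x in at_top.
    \<bar>mean (\<lambda>n. a (big_omega n)) (x * exp (\<delta> * k)) - mean (\<lambda>n. a (big_omega n)) x\<bar> \<le> 8 * \<delta>"
proof -
  define f f' where "f = (\<lambda>n. a (big_omega n))" and "f' = (\<lambda>n. a (Suc (big_omega n)))"
  define \<mu> where "\<mu> u = min (tile_weight \<delta> u) (tile_weight \<delta> (u + k))" for u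
  have \<mu>0: "\<mu> u \<ge> 0" for u by (simp add: \<mu>_def tile_weight_nonneg)
  \<comment> \<open>The bound \<open>8 / \<delta>\<^sup>2\<close> is what makes
    \<open>sqrt (2 * L) \<le> \<delta> * L / 2\<close>. Each of the two comparisons then costs at
    most \<open>4 * \<delta> * L\<close>.\<close>
  have "\<exists>V. (\<Sum>u<V. \<mu> u) > 8 / \<delta>\<^sup>2"
  proof (rule ccontr)
    assume "\<nexists>V. (\<Sum>u<V. \<mu> u) > 8 / \<delta>\<^sup>2"
    then have "summable \<mu>" using \<mu>0 by (intro summableI_nonneg_bounded) (auto simp: not_less)
    with overlap show False by (simp add: \<mu>_def[abs_def])
  qed
  then obtain V where V: "(\<Sum>u<V. \<mu> u) > 8 / \<delta>\<^sup>2" by blast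
  define L where "L = (\<Sum>u<V. \<mu> u)"
  have "8 / \<delta>\<^sup>2 > 0" using \<delta> by simp
  with V have L: "L > 0" "8 / \<delta>\<^sup>2 \<le> L" unfolding L_def by linarith+
  have "sqrt (2 * L) \<le> \<delta> * L / 2"
  proof (rule real_le_lsqrt)
    have "8 \<le> L * \<delta>\<^sup>2" using L(2) \<delta> by (simp add: field_simps)
    then have "8 * L \<le> (L * \<delta>\<^sup>2) * L" using L(1) by (intro mult_right_mono) auto
    then show "2 * L \<le> (\<delta> * L / 2)\<^sup>2" by (simp add: power2_eq_square field_simps)
  qed (use L \<delta> in auto)
  moreover have "\<delta> * L > 0" using L \<delta> by simp
  ultimately have err: "sqrt (2 * L) + 3 * \<delta> * L \<le> 4 * \<delta> * L" by linarith
  have low: "\<forall>\<^sub>F x in at_top. \<bar>(\<Sum>u<V. \<mu> u * mean f' (x / exp (\<delta> * u))) - L * mean f x\<bar>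
      \<le> sqrt (2 * L) + 3 * \<delta> * L"
    unfolding L_def f_def f'_def using a \<delta> \<mu>0 by (intro tile_mean_approx) (auto simp: \<mu>_def)
  have shift: "(\<Sum>v\<in>{k..<V + k}. g v) = (\<Sum>u<V. g (u + k))" for g :: "nat \<Rightarrow> real"
    using sum.shift_bounds_nat_ivl[of g 0 k V] by (simp add: lessThan_atLeast0)
  \<comment> \<open>The same masses moved up by \<open>k\<close> tiles are still admissible, because
    \<open>\<mu> u\<close> is also bounded by the weight of tile \<open>u + k\<close>. At
    \<open>x * exp (\<delta> * k)\<close> the dilations cancel and the average in \<open>low\<close>
    reappears.\<close>
  have "\<forall>\<^sub>F x in at_top. \<bar>(\<Sum>v\<in>{k..<V + k}. \<mu> (v - k) * mean f' (x / exp (\<delta> * v)))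
      - (\<Sum>v\<in>{k..<V + k}. \<mu> (v - k)) * mean f x\<bar>
      \<le> sqrt (2 * (\<Sum>v\<in>{k..<V + k}. \<mu> (v - k))) + 3 * \<delta> * (\<Sum>v\<in>{k..<V + k}. \<mu> (v - k))"
    unfolding f_def f'_def using a \<delta> \<mu>0 by (intro tile_mean_approx) (auto simp: \<mu>_def)
  then have "\<forall>\<^sub>F x in at_top. \<bar>(\<Sum>u<V. \<mu> u * mean f' (x / exp (\<delta> * (u + k)))) - L * mean f x\<bar>
      \<le> sqrt (2 * L) + 3 * \<delta> * L"
    unfolding shift by (simp add: L_def)
  moreover have "filterlim (\<lambda>x. x * exp (\<delta> * k)) at_top at_top"
    by (rule filterlim_at_top_mult_tendsto_pos[OF tendsto_const _ filterlim_ident]) simp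
  ultimately have "\<forall>\<^sub>F x in at_top. \<bar>(\<Sum>u<V. \<mu> u * mean f' (x * exp (\<delta> * k) / exp (\<delta> * (u + k))))
      - L * mean f (x * exp (\<delta> * k))\<bar> \<le> sqrt (2 * L) + 3 * \<delta> * L"
    by (rule eventually_compose_filterlim)
  moreover have "x * exp (\<delta> * k) / exp (\<delta> * (u + k)) = x / exp (\<delta> * u)" for x u :: real
    by (simp add: ring_distribs exp_add)
  ultimately have "\<forall>\<^sub>F x in at_top. \<bar>(\<Sum>u<V. \<mu> u * mean f' (x / exp (\<delta> * u)))
      - L * mean f (x * exp (\<delta> * k))\<bar> \<le> sqrt (2 * L) + 3 * \<delta> * L"
    by simp
  then show ?thesis
    using low
  proof eventually_elim
    case (elim x)
    have "\<bar>L * (mean f (x * exp (\<delta> * k)) - mean f x)\<bar> \<le> L * (8 * \<delta>)"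
      using elim err unfolding right_diff_distrib by (simp add: mult_ac)
    then show ?case using L(1) by (simp add: abs_mult f_def)
  qed
qed

section \<open>A pigeonhole argument for translates\<close>

lemma harm_le_ln: "n \<ge> 1 \<Longrightarrow> harm n \<le> ln (real n) + 1"
  using decseqD[OF decseq_harm_diff_ln, of 0 "n - 1"] by (simp add: harm_expand)

text \<open>If all these sums converged, the \<open>J + 1\<close> translates of \<open>w\<close> would essentially have
  disjoint supports, and their sum could be bounded by \<open>W / v\<close>.\<close>
lemma exists_overlapping_shift:
  fixes w :: "nat \<Rightarrow> real"
  assumes w0: "\<And>u. w u \<ge> 0" and W0: "W \<ge> 0" and upper: "\<forall>\<^sub>F u in sequentially. w u \<le> W / u"
    and lower: "\<And>V. V \<ge> 1 \<Longrightarrow> ln (real V) - C \<le> (\<Sum>u<V. w u)"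
    and J: "W < real J + 1"
  shows "\<exists>j\<in>{1..J}. \<not> summable (\<lambda>u. min (w u) (w (u + j * R)))"
proof (rule ccontr)
  assume "\<not> ?thesis"
  then have summ: "summable (\<lambda>u. min (w u) (w (u + j * R)))" if "1 \<le> j" "j \<le> J" for j
    using that by auto
  \<comment> \<open>Total overlap at \<open>v\<close> of all pairs of distinct translates by
    \<open>i * R\<close> with \<open>i \<le> J\<close>. Their offsets differ by \<open>j * R\<close>
    with \<open>1 \<le> j \<le> J\<close>, so the assumption makes \<open>D\<close>
    summable.\<close>
  define D where "D v = (\<Sum>i\<le>J. \<Sum>j\<in>{..J} - {i}. min (w (v + i * R)) (w (v + j * R)))" for v
  define T where "T v = (\<Sum>i\<le>J. w (v + i * R))" for v
  have D0: "D v \<ge> 0" for v unfolding D_def by (intro sum_nonneg) (auto simp: w0)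
  have less: "summable (\<lambda>v. min (w (v + i * R)) (w (v + j * R)))" if "i < j" "j \<le> J" for i j
  proof -
    have "summable (\<lambda>v. min (w (v + i * R)) (w (v + i * R + (j - i) * R)))"
      using summable_ignore_initial_segment[OF summ[of "j - i"], of "i * R"] that by simp
    moreover have "v + i * R + (j - i) * R = v + j * R" for v
      using that by (simp add: diff_mult_distrib)
    ultimately show ?thesis by simp
  qed
  have summable_D: "summable D"
    unfolding D_def
  proof (intro summable_sum)
    fix i j assume "i \<in> {..J}" "j \<in> {..J} - {i}"
    then show "summable (\<lambda>v. min (w (v + i * R)) (w (v + j * R)))"
      using less[of i j] less[of j i] by (cases "i < j") (auto simp: min.commute)
  qed
  obtain v0 where v0: "\<And>u. u \<ge> v0 \<Longrightarrow> w u \<le> W / u"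
    using upper by (auto simp: eventually_sequentially)
  \<comment> \<open>The largest translate at \<open>v\<close> is at most \<open>W / v\<close>; each
    other one equals its minimum with the largest and is counted in \<open>D v\<close>. The cut at
    \<open>Suc v0\<close> also keeps \<open>v\<close> positive in the second case.\<close>
  have T_le: "T v \<le> (if v < Suc v0 then T v else 0) + (W * inverse (real v) + D v)" for v
  proof (cases "v < Suc v0")
    case True
    then show ?thesis using W0 D0[of v] by simp
  next
    case False
    define M where "M = Max ((\<lambda>i. w (v + i * R)) ` {..J})"
    have "M \<in> (\<lambda>i. w (v + i * R)) ` {..J}" unfolding M_def by (intro Max_in) auto
    then obtain m where m: "m \<le> J" "M = w (v + m * R)" by auto
    have max: "w (v + i * R) \<le> w (v + m * R)" if "i \<le> J" for i
      unfolding m(2)[symmetric] M_def using that by (intro Max_ge) auto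
    have "T v = w (v + m * R) + (\<Sum>j\<in>{..J} - {m}. w (v + j * R))"
      unfolding T_def using m by (intro sum.remove) auto
    also have "w (v + m * R) \<le> W / real (v + m * R)" using False by (intro v0) simp
    also have "\<dots> \<le> W / v" using False W0 by (intro frac_le) auto
    also have "(\<Sum>j\<in>{..J} - {m}. w (v + j * R)) = (\<Sum>j\<in>{..J} - {m}. min (w (v + m * R)) (w (v + j * R)))"
      using max by (intro sum.cong) auto
    also have "\<dots> \<le> D v"
      unfolding D_def using m w0
      by (intro member_le_sum[where f = "\<lambda>i. \<Sum>j\<in>{..J} - {i}. min (w (v + i * R)) (w (v + j * R))"] sum_nonneg) auto
    finally show ?thesis using False by (simp add: field_simps)
  qed
  define K where "K = (\<Sum>v<Suc v0. T v) + W + suminf D + (real J + 1) * (C + (\<Sum>u<J * R. w u))"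
  have T0: "T v \<ge> 0" for v unfolding T_def by (intro sum_nonneg) (auto simp: w0)
  \<comment> \<open>Each of the \<open>J + 1\<close> translates contributes at least
    \<open>ln V\<close> up to a constant, whereas \<open>T_le\<close> allows only
    \<open>W * ln V\<close> in total. As \<open>W < J + 1\<close>, this fails for large
    \<open>V\<close>.\<close>
  have main: "(real J + 1 - W) * ln (real V) \<le> K" if V: "V \<ge> 1" for V
  proof -
    have "(real J + 1) * (ln V - C - (\<Sum>u<J * R. w u)) = (\<Sum>i\<le>J. ln V - C - (\<Sum>u<J * R. w u))"
      by simp
    also have "\<dots> \<le> (\<Sum>i\<le>J. \<Sum>v<V. w (v + i * R))"
    proof (intro sum_mono)
      fix i assume i: "i \<in> {..J}"
      have "(\<Sum>u<V. w u) \<le> (\<Sum>u<V + i * R. w u)" using w0 by (intro sum_mono2) auto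
      also have "\<dots> = (\<Sum>u<i * R. w u) + (\<Sum>u=i * R..<V + i * R. w u)"
        by (metis sum.atLeastLessThan_concat lessThan_atLeast0 le_add2 zero_le)
      also have "(\<Sum>u=i * R..<V + i * R. w u) = (\<Sum>v<V. w (v + i * R))"
        using sum.shift_bounds_nat_ivl[of w 0 "i * R" V] by (simp add: lessThan_atLeast0)
      also have "(\<Sum>u<i * R. w u) \<le> (\<Sum>u<J * R. w u)"
        using w0 i by (intro sum_mono2) (auto intro: less_le_trans)
      finally show "ln V - C - (\<Sum>u<J * R. w u) \<le> (\<Sum>v<V. w (v + i * R))"
        using lower[OF V] by linarith
    qed
    also have "\<dots> = (\<Sum>v<V. T v)" unfolding T_def by (rule sum.swap)
    also have "\<dots> \<le> (\<Sum>v<V. (if v < Suc v0 then T v else 0) + (W * inverse (real v) + D v))"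
      by (intro sum_mono T_le)
    also have "\<dots> = (\<Sum>v<V. if v < Suc v0 then T v else 0) + (W * (\<Sum>v<V. inverse (real v)) + (\<Sum>v<V. D v))"
      by (simp only: sum.distrib sum_distrib_left)
    also have "(\<Sum>v<V. if v < Suc v0 then T v else 0) = (\<Sum>v\<in>{..<V} \<inter> {..<Suc v0}. T v)"
      by (subst sum.inter_restrict) (auto intro!: sum.cong)
    also have "\<dots> \<le> (\<Sum>v<Suc v0. T v)" using T0 by (intro sum_mono2) auto
    also have "W * (\<Sum>v<V. inverse (real v)) \<le> W * (ln V + 1)"
    proof (intro mult_left_mono W0)
      have "(\<Sum>v<V. inverse (real v)) \<le> harm V"
        unfolding harm_def using V
        by (subst sum.mono_neutral_right[of "{..<V}" "{1..<V}"]) (auto intro!: sum_mono2)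
      also have "\<dots> \<le> ln V + 1" by (rule harm_le_ln[OF V])
      finally show "(\<Sum>v<V. inverse (real v)) \<le> ln V + 1" .
    qed
    also have "(\<Sum>v<V. D v) \<le> suminf D" by (rule sum_le_suminf[OF summable_D]) (auto simp: D0)
    finally show ?thesis using W0 unfolding K_def by (simp add: algebra_simps)
  qed
  have "filterlim (\<lambda>V. (real J + 1 - W) * ln (real V)) at_top sequentially"
    using J by (intro filterlim_tendsto_pos_mult_at_top[OF tendsto_const]
      filterlim_compose[OF ln_at_top] filterlim_real_sequentially) auto
  then have "\<forall>\<^sub>F V in sequentially. (real J + 1 - W) * ln (real V) > K"
    by (simp add: filterlim_at_top_dense)
  then have "\<forall>\<^sub>F V in sequentially. False"
    using eventually_ge_at_top[of 1] by eventually_elim (use main in \<open>auto simp: not_le[symmetric]\<close>)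
  then show False by simp
qed

section \<open>Invariance of means under shifts of the number of prime factors\<close>

lemma eventually_mean_iterate:
  assumes "\<forall>\<^sub>F x in at_top. \<bar>mean f (x * exp h) - mean f x\<bar> \<le> e"
  shows "\<forall>\<^sub>F x in at_top. \<bar>mean f (x * exp (real n * h)) - mean f x\<bar> \<le> n * e"
proof (induction n)
  case (Suc n)
  have "filterlim (\<lambda>x. x * exp (n * h)) at_top at_top"
    by (rule filterlim_at_top_mult_tendsto_pos[OF tendsto_const _ filterlim_ident]) simp
  from eventually_compose_filterlim[OF assms this] Suc show ?case
  proof eventually_elim
    case (elim x)
    have "x * exp (n * h) * exp h = x * exp (Suc n * h)" by (simp add: exp_add ring_distribs)
    with elim show ?case by (simp add: ring_distribs)
  qed
qed simp

text \<open>For \<open>h = \<delta> * j * R\<close> from \<open>exists_overlapping_shift\<close>, about \<open>s / h\<close> steps of size \<open>h\<close> and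
  error \<open>8 * \<delta>\<close> lead to \<open>s\<close> up to a remainder below \<open>h\<close>. The total error is of order
  \<open>1 / R + J * R * \<delta>\<close>, where \<open>J\<close> grows only like \<open>ln (1 / \<delta>)\<close>.\<close>
lemma mean_scale_tendsto:
  fixes a :: "nat \<Rightarrow> real"
  assumes a: "\<And>n. \<bar>a n\<bar> \<le> 1" and s: "s \<ge> 0"
  defines "f \<equiv> \<lambda>n. a (big_omega n)"
  shows "((\<lambda>x. mean f (x * exp s) - mean f x) \<longlongrightarrow> 0) at_top"
proof (rule tendstoI)
  fix \<epsilon> :: real assume \<epsilon>: "\<epsilon> > 0"
  \<comment> \<open>\<open>R\<close> is fixed before \<open>\<delta>\<close>: since
    \<open>h \<ge> \<delta> * R\<close>, at most \<open>s / (\<delta> * R)\<close> steps are made,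
    at a total cost of at most \<open>8 * s / R\<close>.\<close>
  obtain R :: nat where R: "24 * s / \<epsilon> < R" using reals_Archimedean2 by blast
  then have "real R > 0" using s \<epsilon> by (intro le_less_trans[OF _ R]) auto
  then have R: "R > 0" "8 * s / R \<le> \<epsilon> / 3" using R \<epsilon> by (auto simp: field_simps)
  \<comment> \<open>The expression bounds \<open>2 * h\<close>, the cost of the remainder, because
    \<open>j \<le> J \<le> W + 1\<close>. It tends to 0 although \<open>W\<close> grows like
    \<open>ln (1 / \<delta>)\<close>.\<close>
  have "((\<lambda>\<delta>::real. 2 * ((3 * (ln (1 / \<delta>) + 1) + 1) * R * \<delta>)) \<longlongrightarrow> 0) (at_right 0)"
    by real_asymp
  then have "\<forall>\<^sub>F \<delta> in at_right (0::real). 2 * ((3 * (ln (1 / \<delta>) + 1) + 1) * R * \<delta>) < \<epsilon> / 3"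
    using \<epsilon> by (intro order_tendstoD) auto
  moreover have "\<forall>\<^sub>F \<delta> in at_right (0::real). \<delta> \<in> {0<..<1/6}"
    by (rule eventually_at_right_real) simp
  ultimately have "\<forall>\<^sub>F \<delta> in at_right (0::real). 2 * ((3 * (ln (1 / \<delta>) + 1) + 1) * R * \<delta>) < \<epsilon> / 3 \<and> 0 < \<delta> \<and> \<delta> \<le> 1 / 6"
    by eventually_elim auto
  then obtain \<delta> :: real where \<delta>: "2 * ((3 * (ln (1 / \<delta>) + 1) + 1) * R * \<delta>) < \<epsilon> / 3" "0 < \<delta>" "\<delta> \<le> 1 / 6"
    using eventually_happens[of _ "at_right (0::real)"] by fastforce
  define W where "W = 3 * (ln (1 / \<delta>) + 1)"
  have "ln (1 / \<delta>) \<ge> 0" using \<delta> by (intro ln_ge_zero) simp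
  then have W0: "W \<ge> 0" by (simp add: W_def)
  define J where "J = nat \<lceil>W\<rceil>"
  have J: "W < real J + 1" "real J \<le> W + 1" unfolding J_def using W0 by linarith+
  have "\<exists>j\<in>{1..J}. \<not> summable (\<lambda>u. min (tile_weight \<delta> u) (tile_weight \<delta> (u + j * R)))"
  proof (rule exists_overlapping_shift[OF tile_weight_nonneg W0 _ _ J(1)])
    show "\<forall>\<^sub>F u in sequentially. tile_weight \<delta> u \<le> W / u"
      unfolding W_def using \<delta> by (intro tile_weight_le)
    show "ln (real V) - (ln 2 - ln \<delta>) \<le> (\<Sum>u<V. tile_weight \<delta> u)" if "V \<ge> 1" for V
      using sum_tile_weight_ge[OF \<delta>(2) that] by simp
  qed
  then obtain j where j: "1 \<le> j" "j \<le> J"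
    and overlap: "\<not> summable (\<lambda>u. min (tile_weight \<delta> u) (tile_weight \<delta> (u + j * R)))" by auto
  define h where "h = \<delta> * real (j * R)"
  have step: "\<forall>\<^sub>F x in at_top. \<bar>mean f (x * exp h) - mean f x\<bar> \<le> 8 * \<delta>"
    unfolding f_def h_def using a \<delta> overlap by (intro mean_shift_of_overlap) auto
  have "\<delta> * (1 * R) \<le> h" unfolding h_def of_nat_mult using j \<delta> by (intro mult_left_mono mult_right_mono) auto
  then have h: "h > 0" "\<delta> * R \<le> h" using \<delta> R by (auto intro: less_le_trans[of 0 "\<delta> * R"])
  have "2 * h \<le> 2 * ((W + 1) * R * \<delta>)"
    unfolding h_def using j J \<delta> by (simp add: mult_ac mult_left_mono)
  then have h_small: "2 * h < \<epsilon> / 3" using \<delta>(1) unfolding W_def by linarith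
  define n where "n = nat \<lfloor>s / h\<rfloor>"
  have "0 \<le> s / h" using s h by simp
  then have "real n \<le> s / h" "s / h < real n + 1" unfolding n_def by linarith+
  then have n: "n * h \<le> s" "s < n * h + h" using h by (auto simp: field_simps)
  have steps: "n * (8 * \<delta>) \<le> \<epsilon> / 3"
  proof -
    have "n * (8 * \<delta>) * R = 8 * (n * (\<delta> * R))" by simp
    also have "\<dots> \<le> 8 * (n * h)" using h by (intro mult_left_mono) auto
    also have "\<dots> \<le> 8 * s" using n by simp
    finally have "n * (8 * \<delta>) \<le> 8 * s / R" using R by (simp add: field_simps)
    then show ?thesis using R by linarith
  qed
  have "\<forall>\<^sub>F x in at_top. \<bar>mean f (x * exp (n * h)) - mean f x\<bar> \<le> n * (8 * \<delta>)"
    by (rule eventually_mean_iterate[OF step])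
  moreover have "\<forall>\<^sub>F x :: real in at_top. x > max 0 (3 / \<epsilon>)" by (rule eventually_gt_at_top)
  ultimately show "\<forall>\<^sub>F x in at_top. dist (mean f (x * exp s) - mean f x) 0 < \<epsilon>"
  proof eventually_elim
    case (elim x)
    have x: "x > 0" "x > 3 / \<epsilon>" using elim(2) by auto
    have "\<bar>mean f (x * exp s) - mean f (x * exp (n * h))\<bar>
        \<le> 2 * (1 - x * exp (n * h) / (x * exp s)) + 1 / (x * exp s)"
      using a x n by (intro mean_lipschitz) (auto simp: f_def)
    also have "x * exp (n * h) / (x * exp s) = exp (n * h - s)" using x by (simp add: exp_diff)
    also have "1 - exp (n * h - s) \<le> h" using exp_ge_add_one_self[of "n * h - s"] n by linarith
    also have "1 / (x * exp s) \<le> 1 / x" using x s by (intro divide_left_mono) auto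
    also have "1 / x < \<epsilon> / 3" using x \<epsilon> by (simp add: field_simps)
    finally show ?case using elim(1) steps h_small by (simp add: dist_real_def)
  qed
qed

text \<open>With the full weights of all tiles below \<open>V\<close>, \<open>mean f x\<close> is
  close to a weighted average of dilated means of \<open>f'\<close>, and by
  \<open>mean_scale_tendsto\<close> each of these is close to \<open>mean f' x\<close>.\<close>

lemma mean_Suc_tendsto:
  fixes a :: "nat \<Rightarrow> real"
  assumes a: "\<And>n. \<bar>a n\<bar> \<le> 1"
  shows "((\<lambda>x. mean (\<lambda>n. a (Suc (big_omega n))) x - mean (\<lambda>n. a (big_omega n)) x) \<longlongrightarrow> 0) at_top"
proof (rule tendstoI)
  fix \<epsilon> :: real assume \<epsilon>: "\<epsilon> > 0"
  define f f' where "f = (\<lambda>n. a (big_omega n))" and "f' = (\<lambda>n. a (Suc (big_omega n)))"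
  \<comment> \<open>The errors add up to \<open>5 * \<delta>\<close>: four from
    \<open>tile_mean_approx\<close>, one from undoing the dilations.\<close>
  define \<delta> where "\<delta> = \<epsilon> / 10"
  have \<delta>: "\<delta> > 0" using \<epsilon> by (simp add: \<delta>_def)
  \<comment> \<open>Large enough for \<open>sum_tile_weight_ge\<close> to give
    \<open>L \<ge> 2 / \<delta>\<^sup>2\<close>, that is
    \<open>sqrt (2 * L) \<le> \<delta> * L\<close>.\<close>
  define V where "V = nat \<lceil>exp (2 / \<delta>\<^sup>2 + ln 2 - ln \<delta>)\<rceil>"
  have V: "exp (2 / \<delta>\<^sup>2 + ln 2 - ln \<delta>) \<le> V" unfolding V_def by linarith
  then have V0: "real V > 0" by (rule less_le_trans[OF exp_gt_zero])
  define L where "L = (\<Sum>u<V. tile_weight \<delta> u)"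
  have "2 / \<delta>\<^sup>2 + ln 2 - ln \<delta> \<le> ln V" using V V0 by (simp add: ln_ge_iff)
  then have L: "2 / \<delta>\<^sup>2 \<le> L" using sum_tile_weight_ge[OF \<delta>, of V] V0 by (simp add: L_def)
  have L0: "L > 0" using L \<delta> by (auto intro: less_le_trans[of 0 "2 / \<delta>\<^sup>2"])
  have "sqrt (2 * L) \<le> \<delta> * L"
  proof (rule real_le_lsqrt)
    have "2 \<le> L * \<delta>\<^sup>2" using L \<delta> by (simp add: field_simps)
    then have "2 * L \<le> (L * \<delta>\<^sup>2) * L" using L0 by (intro mult_right_mono) auto
    then show "2 * L \<le> (\<delta> * L)\<^sup>2" by (simp add: power2_eq_square mult_ac)
  qed (use L0 \<delta> in auto)
  then have err: "sqrt (2 * L) + 3 * \<delta> * L \<le> 4 * \<delta> * L" by linarith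
  have "\<forall>\<^sub>F x in at_top. \<bar>(\<Sum>u<V. tile_weight \<delta> u * mean f' (x / exp (\<delta> * u))) - L * mean f x\<bar>
      \<le> sqrt (2 * L) + 3 * \<delta> * L"
    unfolding f_def f'_def L_def using a \<delta> by (intro tile_mean_approx) (auto simp: tile_weight_nonneg)
  moreover have "\<forall>\<^sub>F x in at_top. \<forall>u\<in>{..<V}. dist (mean f' x - mean f' (x / exp (\<delta> * u))) 0 < \<delta>"
  proof (intro eventually_ball_finite ballI)
    fix u :: nat
    have "((\<lambda>x. mean f' (x * exp (\<delta> * u)) - mean f' x) \<longlongrightarrow> 0) at_top"
      unfolding f'_def using a \<delta> by (intro mean_scale_tendsto[where a = "\<lambda>n. a (Suc n)"]) auto
    moreover have "filterlim (\<lambda>x. x / exp (\<delta> * u)) at_top at_top"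
      unfolding divide_inverse
      by (rule filterlim_at_top_mult_tendsto_pos[OF tendsto_const _ filterlim_ident]) simp
    ultimately have "((\<lambda>x. mean f' (x / exp (\<delta> * u) * exp (\<delta> * u)) - mean f' (x / exp (\<delta> * u))) \<longlongrightarrow> 0) at_top"
      by (rule filterlim_compose)
    then show "\<forall>\<^sub>F x in at_top. dist (mean f' x - mean f' (x / exp (\<delta> * u))) 0 < \<delta>"
      using \<delta> by (intro tendstoD) auto
  qed simp
  ultimately show "\<forall>\<^sub>F x in at_top. dist (mean (\<lambda>n. a (Suc (big_omega n))) x - mean (\<lambda>n. a (big_omega n)) x) 0 < \<epsilon>"
  proof eventually_elim
    case (elim x)
    have "L * mean f' x - (\<Sum>u<V. tile_weight \<delta> u * mean f' (x / exp (\<delta> * u)))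
        = (\<Sum>u<V. tile_weight \<delta> u * (mean f' x - mean f' (x / exp (\<delta> * u))))"
      by (simp add: L_def sum_distrib_right right_diff_distrib sum_subtractf)
    also have "\<bar>\<dots>\<bar> \<le> (\<Sum>u<V. tile_weight \<delta> u * \<delta>)"
    proof (rule order_trans[OF sum_abs sum_mono])
      fix u assume "u \<in> {..<V}"
      then have "\<bar>mean f' x - mean f' (x / exp (\<delta> * u))\<bar> \<le> \<delta>" using elim(2) by (auto simp: dist_real_def less_imp_le)
      then show "\<bar>tile_weight \<delta> u * (mean f' x - mean f' (x / exp (\<delta> * u)))\<bar> \<le> tile_weight \<delta> u * \<delta>"
        by (simp add: abs_mult tile_weight_nonneg mult_left_mono)
    qed
    also have "\<dots> = L * \<delta>" by (simp add: L_def sum_distrib_right)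
    finally have "\<bar>L * (mean f' x - mean f x)\<bar> \<le> L * (5 * \<delta>)"
      using elim(1) err unfolding right_diff_distrib by (simp add: mult_ac)
    then have "\<bar>mean f' x - mean f x\<bar> \<le> 5 * \<delta>" using L0 by (simp add: abs_mult)
    also have "\<dots> < \<epsilon>" using \<epsilon> by (simp add: \<delta>_def)
    finally show ?case by (simp add: dist_real_def f_def f'_def)
  qed
qed

lemma mean_add_tendsto:
  fixes a :: "nat \<Rightarrow> real"
  assumes a: "\<And>n. \<bar>a n\<bar> \<le> 1"
  shows "((\<lambda>x. mean (\<lambda>n. a (h + big_omega n)) x - mean (\<lambda>n. a (big_omega n)) x) \<longlongrightarrow> 0) at_top"
proof (induction h)
  case (Suc h)
  have "((\<lambda>x. mean (\<lambda>n. a (h + Suc (big_omega n))) x - mean (\<lambda>n. a (h + big_omega n)) x) \<longlongrightarrow> 0) at_top"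
    using a by (intro mean_Suc_tendsto)
  from tendsto_add[OF this Suc] show ?case by simp
qed simp

text \<open>All shifts \<open>a (h + big_omega n)\<close> have asymptotically the same mean, so it
  can be averaged over \<open>h < H\<close>. The window sum is then small for every
  \<open>n\<close>, because its bound is uniform in the starting point
  \<open>k = big_omega n\<close>.\<close>

theorem mean_big_omega_tendsto_0:
  fixes a :: "nat \<Rightarrow> real"
  assumes a: "\<And>n. \<bar>a n\<bar> \<le> 1"
    and uniform: "\<And>\<epsilon>. \<epsilon> > 0 \<Longrightarrow> \<exists>H>0. \<forall>k. \<bar>\<Sum>h<H. a (h + k)\<bar> \<le> \<epsilon> * real H"
  shows "((\<lambda>x. mean (\<lambda>n. a (big_omega n)) x) \<longlongrightarrow> 0) at_top"
proof (rule tendstoI)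
  fix \<epsilon> :: real assume \<epsilon>: "\<epsilon> > 0"
  define f where "f = (\<lambda>h n. a (h + big_omega n))"
  obtain H where H: "H > 0" "\<And>k. \<bar>\<Sum>h<H. a (h + k)\<bar> \<le> \<epsilon> / 2 * H" using uniform[of "\<epsilon> / 2"] \<epsilon> by auto
  have "((\<lambda>x. \<Sum>h<H. mean (f h) x - mean (f 0) x) \<longlongrightarrow> (\<Sum>h<H. 0)) at_top"
    unfolding f_def add_0 using a by (intro tendsto_sum mean_add_tendsto)
  then have "\<forall>\<^sub>F x in at_top. dist (\<Sum>h<H. mean (f h) x - mean (f 0) x) 0 < \<epsilon> / 2 * H"
    using \<epsilon> H by (intro tendstoD) auto
  moreover have "\<forall>\<^sub>F x :: real in at_top. x > 0" by (rule eventually_gt_at_top)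
  ultimately show "\<forall>\<^sub>F x in at_top. dist (mean (\<lambda>n. a (big_omega n)) x) 0 < \<epsilon>"
  proof eventually_elim
    case (elim x)
    have "(\<Sum>h<H. mean (f h) x) = (\<Sum>n=1..nat \<lfloor>x\<rfloor>. \<Sum>h<H. a (h + big_omega n)) / x"
      unfolding mean_def f_def sum_divide_distrib[symmetric] by (subst sum.swap) simp
    also have "\<bar>\<dots>\<bar> \<le> (\<Sum>n=1..nat \<lfloor>x\<rfloor>. \<epsilon> / 2 * H) / x"
      using elim(2) H(2) unfolding abs_divide
      by (intro frac_le order_trans[OF sum_abs sum_mono] sum_nonneg) (use \<epsilon> in auto)
    also have "\<dots> = real (nat \<lfloor>x\<rfloor>) / x * (\<epsilon> / 2 * H)" by simp
    also have "\<dots> \<le> 1 * (\<epsilon> / 2 * H)"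
      using elim(2) \<epsilon> by (intro mult_right_mono) (auto simp: divide_le_eq_1 of_nat_floor)
    finally have "\<bar>\<Sum>h<H. mean (f h) x\<bar> \<le> \<epsilon> / 2 * H" by simp
    moreover have "(\<Sum>h<H. mean (f h) x - mean (f 0) x) = (\<Sum>h<H. mean (f h) x) - H * mean (f 0) x"
      by (simp add: sum_subtractf)
    ultimately have "\<bar>H * mean (f 0) x\<bar> < H * \<epsilon>"
      using elim(1) by (simp add: dist_real_def field_simps) 
    then show ?case using H(1) by (simp add: abs_mult f_def dist_real_def)
  qed
qed

section \<open>Sums of digits\<close>

text \<open>Frees the index range from its dependence on \<open>n\<close>, so that digit sums of
  different numbers can be compared; positions past the leading digit contribute 0.\<close>

lemma digit_sum_eq_sum:
  assumes "q \<ge> 2" "n \<le> K"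
  shows "digit_sum q n = (\<Sum>k<K. digit q n k)"
  unfolding digit_sum_def
proof (rule sum.mono_neutral_left)
  show "{k. q ^ k \<le> n} \<subseteq> {..<K}"
  proof
    fix k assume "k \<in> {k. q ^ k \<le> n}"
    moreover have "k < q ^ k" using assms(1) by (metis less_exp less_le_trans power_mono zero_le)
    ultimately show "k \<in> {..<K}" using assms(2) by simp
  qed
qed (auto simp: digit_def not_le)

lemma digit_sum_step:
  assumes q: "q \<ge> 2" and i: "i < q"
  shows "digit_sum q (n * q + i) = digit_sum q n + i"
proof -
  define N where "N = n * q + i"
  have N: "N mod q = i" "N div q = n" using i by (simp_all add: N_def)
  have "n * 1 \<le> n * q" using q by (intro mult_left_mono) auto
  then have "n \<le> N" unfolding N_def by linarith
  have "digit_sum q N = (\<Sum>k<Suc N. digit q N k)" using q by (intro digit_sum_eq_sum) auto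
  also have "\<dots> = i + (\<Sum>k<N. digit q N (Suc k))"
    by (simp only: sum.lessThan_Suc_shift) (simp add: digit_def N)
  also have "(\<Sum>k<N. digit q N (Suc k)) = (\<Sum>k<N. digit q n k)"
    by (simp add: digit_def N div_mult2_eq)
  also have "\<dots> = digit_sum q n" using q \<open>n \<le> N\<close> by (intro digit_sum_eq_sum[symmetric])
  finally show ?thesis by (simp add: N_def)
qed

text \<open>Over an aligned block the \<open>j\<close> lowest digits vary independently while the
  higher ones stay those of \<open>k\<close>, so the sum factorises.\<close>

lemma sum_power_digit_sum:
  fixes z :: complex
  assumes q: "q \<ge> 2"
  shows "(\<Sum>i<q ^ j. z ^ digit_sum q (k * q ^ j + i)) = z ^ digit_sum q k * (\<Sum>i<q. z ^ i) ^ j"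
proof (induction j)
  case (Suc j)
  \<comment> \<open>Runs of length \<open>q\<close>, within which only the lowest digit
    changes.\<close>
  have "(\<Sum>i<q ^ Suc j. z ^ digit_sum q (k * q ^ Suc j + i))
      = (\<Sum>l<q ^ j. \<Sum>i\<in>{l * q..<l * q + q}. z ^ digit_sum q (k * q ^ Suc j + i))"
    by (simp add: sum.nat_group mult.commute)
  also have "\<dots> = (\<Sum>l<q ^ j. \<Sum>i<q. z ^ (digit_sum q (k * q ^ j + l) + i))"
  proof (rule sum.cong[OF refl])
    fix l
    have "(\<Sum>i\<in>{l * q..<l * q + q}. z ^ digit_sum q (k * q ^ Suc j + i))
        = (\<Sum>i<q. z ^ digit_sum q (k * q ^ Suc j + (i + l * q)))"
      using sum.shift_bounds_nat_ivl[of "\<lambda>i. z ^ digit_sum q (k * q ^ Suc j + i)" 0 "l * q" q]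
      by (simp add: lessThan_atLeast0 add.commute)
    also have "\<dots> = (\<Sum>i<q. z ^ (digit_sum q (k * q ^ j + l) + i))"
    proof (intro sum.cong refl)
      fix i assume "i \<in> {..<q}"
      moreover have "k * q ^ Suc j + (i + l * q) = (k * q ^ j + l) * q + i"
        by (simp add: algebra_simps)
      ultimately show "z ^ digit_sum q (k * q ^ Suc j + (i + l * q)) = z ^ (digit_sum q (k * q ^ j + l) + i)"
        using digit_sum_step[OF q, of i] by (simp only: lessThan_iff)
    qed
    finally show "(\<Sum>i\<in>{l * q..<l * q + q}. z ^ digit_sum q (k * q ^ Suc j + i))
        = (\<Sum>i<q. z ^ (digit_sum q (k * q ^ j + l) + i))" .
  qed
  also have "\<dots> = (\<Sum>l<q ^ j. z ^ digit_sum q (k * q ^ j + l)) * (\<Sum>i<q. z ^ i)"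
    by (simp add: power_add sum_product)
  finally show ?case using Suc by (simp add: mult_ac)
qed simp

text \<open>The first two terms already lose: \<open>norm (1 + z) < 2\<close> unless
  \<open>z = 1\<close>. Every other term has norm 1.\<close>

lemma norm_geometric_sum_less:
  fixes z :: complex
  assumes "q \<ge> 2" "norm z = 1" "z \<noteq> 1"
  shows "norm (\<Sum>i<q. z ^ i) < real q"
proof -
  have "(\<Sum>i<q. z ^ i) = (\<Sum>i<2. z ^ i) + (\<Sum>i\<in>{..<q} - {..<2}. z ^ i)"
    using assms(1) by (intro sum.subset_diff[THEN trans[OF _ add.commute]]) auto
  also have "(\<Sum>i<2. z ^ i) = 1 + z" by (simp add: numeral_2_eq_2)
  also have "norm (1 + z + (\<Sum>i\<in>{..<q} - {..<2}. z ^ i)) \<le> norm (1 + z) + (\<Sum>i\<in>{..<q} - {..<2}. norm (z ^ i))"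
    by (intro order_trans[OF norm_triangle_ineq] add_left_mono norm_sum)
  also have "(\<Sum>i\<in>{..<q} - {..<2}. norm (z ^ i)) = real (q - 2)"
    using assms by (simp add: norm_power card_Diff_subset)
  also have "norm (1 + z) < 2"
  proof -
    have sq: "(Re z)\<^sup>2 + (Im z)\<^sup>2 = 1" using assms(2) by (simp add: cmod_def)
    have "Re z \<noteq> 1" using sq assms(3) by (auto simp: complex_eq_iff)
    moreover have "Re z \<le> 1" using complex_Re_le_cmod[of z] assms(2) by simp
    moreover have "(norm (1 + z))\<^sup>2 = 2 + 2 * Re z"
      using sq unfolding cmod_power2 by (simp add: power2_eq_square algebra_simps)
    ultimately have "(norm (1 + z))\<^sup>2 < 2\<^sup>2" by simp
    then show ?thesis by (rule power_less_imp_less_base) simp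
  qed
  finally show ?thesis using assms(1) by (simp add: of_nat_diff)
qed

text \<open>Orthogonality of characters: exchanging the roles of \<open>t\<close> and
  \<open>n\<close> gives a geometric sum in \<open>\<omega>\<close> with
  \<open>\<omega> ^ m = 1\<close>.\<close>

lemma roots_of_unity_indicator:
  fixes m n :: nat
  assumes "m \<ge> 1"
  shows "(\<Sum>t<m. exp (2 * of_real pi * \<i> * t / m) ^ n) = (if m dvd n then of_nat m else (0::complex))"
proof -
  define \<omega> :: complex where "\<omega> = exp (2 * of_real pi * \<i> * n / m)"
  have "exp (2 * of_real pi * \<i> * t / m) ^ n = \<omega> ^ t" for t :: nat
    unfolding \<omega>_def by (simp add: mult_ac flip: exp_of_nat_mult)
  then have eq: "(\<Sum>t<m. exp (2 * of_real pi * \<i> * t / m) ^ n) = (\<Sum>t<m. \<omega> ^ t)" by simp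
  have \<omega>1: "\<omega> = 1 \<longleftrightarrow> m dvd n"
    unfolding \<omega>_def using complex_root_unity_eq_1[OF assms, of n] by simp
  have \<omega>m: "\<omega> ^ m = 1"
    unfolding \<omega>_def using complex_root_unity[of m n] assms by simp
  show ?thesis
    unfolding eq using \<omega>1 \<omega>m by (auto simp: geometric_sum)
qed

text \<open>Moving both ends of a window down to multiples of \<open>Q\<close> costs at most
  \<open>Q\<close> each and leaves whole aligned blocks.\<close>

lemma uniform_windows_of_blocks:
  fixes b :: "nat \<Rightarrow> real"
  assumes b: "\<And>n. \<bar>b n\<bar> \<le> 1" and Q: "Q > 0" and \<epsilon>: "\<epsilon> > 0"
    and blocks: "\<And>k. \<bar>\<Sum>i<Q. b (k * Q + i)\<bar> \<le> \<epsilon> / 2 * Q"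
  shows "\<exists>H>0. \<forall>k. \<bar>\<Sum>h<H. b (h + k)\<bar> \<le> \<epsilon> * real H"
proof -
  define T where "T n = (\<Sum>i<n. b i)" for n
  have shift: "T (n + k) - T k = (\<Sum>h<n. b (h + k))" for n k
    unfolding T_def using sum.shift_bounds_nat_ivl[of b 0 k n]
    by (simp add: lessThan_atLeast0 sum_diff_nat_ivl)
  have short: "\<bar>T n - T (n div Q * Q)\<bar> \<le> Q" for n
  proof -
    have "T n - T (n div Q * Q) = (\<Sum>h<n mod Q. b (h + n div Q * Q))"
      using shift[of "n mod Q" "n div Q * Q"] by simp
    also have "\<bar>\<dots>\<bar> \<le> (\<Sum>h<n mod Q. 1)" by (rule order_trans[OF sum_abs sum_mono]) (rule b)
    also have "\<dots> \<le> Q" using Q by (simp add: less_imp_le)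
    finally show ?thesis .
  qed
  have long: "\<bar>T ((l + d) * Q) - T (l * Q)\<bar> \<le> \<epsilon> / 2 * Q * d" for l d
  proof (induction d)
    case (Suc d)
    have "T ((l + Suc d) * Q) - T ((l + d) * Q) = (\<Sum>i<Q. b ((l + d) * Q + i))"
      using shift[of Q "(l + d) * Q"] by (simp add: algebra_simps)
    then have "\<bar>T ((l + Suc d) * Q) - T ((l + d) * Q)\<bar> \<le> \<epsilon> / 2 * Q" using blocks[of "l + d"] by simp
    moreover have "\<epsilon> / 2 * Q * Suc d = \<epsilon> / 2 * Q * d + \<epsilon> / 2 * Q" by (simp add: algebra_simps)
    ultimately show ?case using Suc by linarith
  qed simp
  \<comment> \<open>The blocks have total length at most \<open>H + Q\<close>; this \<open>H\<close>
    makes the excess \<open>\<epsilon> / 2 * Q\<close> and the end costs \<open>2 * Q\<close> fit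
    into the remaining \<open>\<epsilon> / 2 * H\<close>.\<close>
  obtain H :: nat where H: "2 * (\<epsilon> / 2 * Q + 2 * Q) / \<epsilon> < H" using reals_Archimedean2 by blast
  have "0 < 2 * (\<epsilon> / 2 * Q + 2 * Q) / \<epsilon>" using \<epsilon> Q by (intro divide_pos_pos mult_pos_pos add_pos_pos) auto
  then have "H > 0" using H by (metis of_nat_0_less_iff less_trans)
  moreover have "\<bar>\<Sum>h<H. b (h + k)\<bar> \<le> \<epsilon> * H" for k
  proof -
    define l d where "l = k div Q" and "d = (H + k) div Q - l"
    have "l \<le> (H + k) div Q" unfolding l_def by (intro div_le_mono) simp
    then have ld: "(H + k) div Q = l + d" by (simp add: d_def)
    have "d * Q + l * Q \<le> H + k"
      unfolding add_mult_distrib[symmetric] add.commute[of d] ld[symmetric] by simp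
    moreover have "k < l * Q + Q" unfolding l_def using Q
      by (metis div_mult_mod_eq add_strict_left_mono mod_less_divisor)
    ultimately have "d * Q \<le> H + Q" by linarith
    then have "real d * Q \<le> H + Q" by (metis of_nat_add of_nat_le_iff of_nat_mult)
    then have "\<epsilon> / 2 * (real d * Q) \<le> \<epsilon> / 2 * (H + Q)" using \<epsilon> by (intro mult_left_mono) auto
    moreover have "\<bar>T ((l + d) * Q) - T (l * Q)\<bar> \<le> \<epsilon> / 2 * (real d * Q)"
      using long[of l d] by (simp only: mult_ac)
    then have "\<bar>T (H + k) - T k\<bar> \<le> \<epsilon> / 2 * (real d * Q) + 2 * Q"
      using short[of "H + k"] short[of k] unfolding ld l_def[symmetric] by linarith
    moreover have "\<epsilon> / 2 * Q + 2 * Q \<le> \<epsilon> / 2 * H" using H \<epsilon> by (simp add: field_simps)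
    ultimately show ?thesis unfolding shift[symmetric] by (simp add: ring_distribs)
  qed
  ultimately show ?thesis by blast
qed

text \<open>Expanded in \<open>m\<close>-th roots of unity, the centred indicator has no term for
  \<open>t = 0\<close>; each other term contributes at most
  \<open>(norm (\<sigma> t) / q) ^ j\<close> relative to the block length, which tends to 0.\<close>

lemma digit_sum_blocks:
  assumes q: "q \<ge> 2" and m: "m \<ge> 1" and r: "r < m" and \<epsilon>: "\<epsilon> > 0"
  shows "\<exists>j. \<forall>k. \<bar>\<Sum>i<q ^ j. of_bool [digit_sum q (k * q ^ j + i) = r] (mod m) - 1 / real m\<bar> \<le> \<epsilon> * real (q ^ j)"
proof -
  define \<zeta> :: "nat \<Rightarrow> complex" where "\<zeta> t = exp (2 * of_real pi * \<i> * t / m)" for t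
  define \<sigma> where "\<sigma> t = (\<Sum>i<q. \<zeta> t ^ i)" for t
  have norm_\<zeta>: "norm (\<zeta> t) = 1" for t by (simp add: \<zeta>_def norm_exp_eq_Re)
  have \<zeta>0: "\<zeta> 0 = 1" by (simp add: \<zeta>_def)
  have \<sigma>: "norm (\<sigma> t) < q" if "t \<in> {1..<m}" for t
    unfolding \<sigma>_def
  proof (rule norm_geometric_sum_less[OF q norm_\<zeta>])
    show "\<zeta> t \<noteq> 1"
      unfolding \<zeta>_def using complex_root_unity_eq_1[OF m, of t] that by (auto dest: dvd_imp_le)
  qed
  have "((\<lambda>j. \<Sum>t\<in>{1..<m}. (norm (\<sigma> t) / q) ^ j) \<longlonglongrightarrow> (\<Sum>t\<in>{1..<m}. 0))"
    using \<sigma> q by (intro tendsto_sum LIMSEQ_realpow_zero) auto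
  then have "\<forall>\<^sub>F j in sequentially. (\<Sum>t\<in>{1..<m}. (norm (\<sigma> t) / q) ^ j) < \<epsilon>"
    using \<epsilon> by (intro order_tendstoD) auto
  then obtain j where j: "(\<Sum>t\<in>{1..<m}. (norm (\<sigma> t) / q) ^ j) < \<epsilon>"
    by (auto dest: eventually_happens)
  have "\<bar>\<Sum>i<q ^ j. of_bool [digit_sum q (k * q ^ j + i) = r] (mod m) - 1 / real m\<bar> \<le> \<epsilon> * real (q ^ j)" for k
  proof -
    define s where "s i = digit_sum q (k * q ^ j + i)" for i
    have split: "{..<m} = insert 0 {1..<m}" using m by auto
    \<comment> \<open>The power \<open>m - r\<close> stands for the exponent \<open>-r\<close>, as
      \<open>\<zeta> t ^ m = 1\<close>. The term \<open>t = 0\<close> is the 1 that cancels against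
      \<open>1 / m\<close>.\<close>
    have ind: "complex_of_real (of_bool [s i = r] (mod m) - 1 / m)
        = (\<Sum>t\<in>{1..<m}. \<zeta> t ^ (m - r) * \<zeta> t ^ s i) / m" for i
    proof -
      have "m dvd (s i + (m - r)) \<longleftrightarrow> [s i + (m - r) = r + (m - r)] (mod m)"
        by (simp only: Cong.cong_def le_add_diff_inverse[OF less_imp_le[OF r]] mod_self mod_eq_0_iff_dvd)
      also have "\<dots> \<longleftrightarrow> [s i = r] (mod m)" by (rule cong_add_rcancel_nat)
      finally have *: "m dvd (s i + (m - r)) \<longleftrightarrow> [s i = r] (mod m)" .
      have "1 + (\<Sum>t\<in>{1..<m}. \<zeta> t ^ (m - r) * \<zeta> t ^ s i) = (\<Sum>t<m. \<zeta> t ^ (s i + (m - r)))"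
        unfolding split by (simp add: \<zeta>0 power_add mult.commute)
      also have "\<dots> = of_bool [s i = r] (mod m) * of_nat m"
        using roots_of_unity_indicator[OF m, of "s i + (m - r)"] * by (simp add: \<zeta>_def)
      finally have "1 + (\<Sum>t\<in>{1..<m}. \<zeta> t ^ (m - r) * \<zeta> t ^ s i) = of_bool [s i = r] (mod m) * of_nat m" .
      then have "(\<Sum>t\<in>{1..<m}. \<zeta> t ^ (m - r) * \<zeta> t ^ s i) = of_bool [s i = r] (mod m) * of_nat m - 1"
        by (rule iffD2[OF eq_diff_eq trans[OF add.commute]])
      then show ?thesis using m by (simp only: diff_divide_distrib) simp
    qed
    have "complex_of_real (\<Sum>i<q ^ j. of_bool [s i = r] (mod m) - 1 / m)
        = (\<Sum>t\<in>{1..<m}. \<zeta> t ^ (m - r) * (\<Sum>i<q ^ j. \<zeta> t ^ s i)) / m"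
      unfolding of_real_sum ind sum_divide_distrib[symmetric] by (subst sum.swap) (simp add: sum_distrib_left)
    \<comment> \<open>\<open>k\<close> survives only in a factor of norm 1, hence one
      \<open>j\<close> serves all \<open>k\<close>.\<close>
    also have "\<dots> = (\<Sum>t\<in>{1..<m}. \<zeta> t ^ (m - r) * (\<zeta> t ^ digit_sum q k * \<sigma> t ^ j)) / m"
      unfolding s_def sum_power_digit_sum[OF q] \<sigma>_def ..
    also have "norm \<dots> \<le> (\<Sum>t\<in>{1..<m}. norm (\<sigma> t) ^ j) / m"
      unfolding norm_divide using m
      by (intro frac_le order_trans[OF norm_sum] sum_mono sum_nonneg) (auto simp: norm_mult norm_power norm_\<zeta>)
    also have "\<dots> \<le> (\<Sum>t\<in>{1..<m}. norm (\<sigma> t) ^ j) / 1"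
      using m by (intro divide_left_mono sum_nonneg) auto
    also have "\<dots> = (\<Sum>t\<in>{1..<m}. (norm (\<sigma> t) / q) ^ j) * real (q ^ j)"
      using q by (simp add: power_divide flip: sum_divide_distrib)
    also have "\<dots> \<le> \<epsilon> * real (q ^ j)" using j by (intro mult_right_mono) auto
    finally show ?thesis unfolding s_def by (simp only: norm_of_real)
  qed
  then show ?thesis by blast
qed

theorem corollary1p7:
  fixes q m :: nat
  assumes "q \<ge> 2" and "m \<ge> 1" and "coprime m (q - 1)"
  shows "\<forall>r\<in>{0..<m}. has_asymptotic_density
           {n. n \<ge> 1 \<and> [digit_sum q (big_omega n) = r] (mod m)} (1 / real m)"
proof
  fix r assume "r \<in> {0..<m}"
  then have r: "r < m" by simp
  \<comment> \<open>The indicator is centred, so that the claim becomes that the mean of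
    \<open>b (big_omega n)\<close> tends to 0.\<close>
  define b where "b n = of_bool [digit_sum q n = r] (mod m) - 1 / real m" for n
  define A where "A = {n. n \<ge> 1 \<and> [digit_sum q (big_omega n) = r] (mod m)}"
  have b: "\<bar>b n\<bar> \<le> 1" for n using assms(2) by (auto simp: b_def divide_le_eq_1)
  have "((\<lambda>x. mean (\<lambda>n. b (big_omega n)) x) \<longlongrightarrow> 0) at_top"
  proof (rule mean_big_omega_tendsto_0[OF b])
    fix \<epsilon> :: real assume \<epsilon>: "\<epsilon> > 0"
    obtain j where "\<And>k. \<bar>\<Sum>i<q ^ j. b (k * q ^ j + i)\<bar> \<le> \<epsilon> / 2 * real (q ^ j)"
      using digit_sum_blocks[OF assms(1,2) r, of "\<epsilon> / 2"] \<epsilon> unfolding b_def by auto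
    then show "\<exists>H>0. \<forall>k. \<bar>\<Sum>h<H. b (h + k)\<bar> \<le> \<epsilon> * real H"
      using assms(1) b \<epsilon> by (intro uniform_windows_of_blocks[of b "q ^ j"]) auto
  qed
  then have "(\<lambda>N. mean (\<lambda>n. b (big_omega n)) (real N) + 1 / m) \<longlonglongrightarrow> 0 + 1 / m"
    by (intro tendsto_add tendsto_const filterlim_compose[OF _ filterlim_real_sequentially])
  \<comment> \<open>Restricted to \<open>N > 0\<close>, since at \<open>N = 0\<close> both quotients
    are 0 and the sides differ by \<open>1 / m\<close>.\<close>
  moreover have "\<forall>\<^sub>F N in sequentially.
      mean (\<lambda>n. b (big_omega n)) (real N) + 1 / m = real (card (A \<inter> {1..N})) / real N"
    using eventually_gt_at_top[of 0]
  proof eventually_elim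
    case (elim N)
    have "real (card (A \<inter> {1..N})) = (\<Sum>n=1..N. of_bool (n \<in> A))"
      by (simp add: Int_commute)
    also have "\<dots> = (\<Sum>n=1..N. b (big_omega n) + 1 / m)"
      by (intro sum.cong) (auto simp: A_def b_def)
    finally show ?case using elim by (simp add: mean_def sum.distrib add_divide_distrib)
  qed
  ultimately show "has_asymptotic_density {n. n \<ge> 1 \<and> [digit_sum q (big_omega n) = r] (mod m)} (1 / real m)"
    unfolding has_asymptotic_density_def A_def[symmetric]
    by (auto elim: Lim_transform_eventually)
qed

end
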